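(* Let $\Omega=(0,1)\times\mathbb{T}^2$. Then $$\|\nabla\mathbf{u}\|_{L^{2}(\Omega)}^2\leq\frac{1}{2}\left\|\nabla\mathbf{u}+\nabla\mathbf{u}^{\mathsf{T}}-\frac{2}{3}(\mathrm{div}\,\mathbf{u})\,\mathbb{I}_3\right\|_{L^{2}(\Omega)}^{2}$$ for all $\mathbf{u}\in V^{1}(\Omega)$.
   Context: $V^{1}(\Omega)$ denotes the space of 3-dimensional vector valued functions in $H^{1}(\Omega)$ whose normal component is zero on $\partial\Omega=\{0,1\}\times\mathbb{T}^2$. $\mathbb{I}_3$ is the $3\times 3$ unit matrix, and the $L^2$ norm of a matrix field is taken with respect to the Frobenius norm. *)

theory Defs
  imports "HOL-Analysis.Analysis"
begin

text \<open>
  The torus is \<open>\<real>/\<int>\<close>. A function on \<open>\<Omega> = (0,1) \<times> \<bbbT>\<^sup>2\<close> is represented by a function on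
  \<open>real ^ 3\<close> that has period 1 in the coordinates 2 and 3 at all points with first coordinate
  in \<open>(0,1)\<close>; its values elsewhere are irrelevant. Integrals over \<open>\<Omega>\<close> are integrals over the
  fundamental cell \<open>(0,1) \<times> [0,1)\<^sup>2\<close>.
\<close>

definition strip :: "(real ^ 3) set" where
  "strip = {x. 0 < x $ 1 \<and> x $ 1 < 1}"

definition cell :: "(real ^ 3) set" where
  "cell = {x. 0 < x $ 1 \<and> x $ 1 < 1 \<and> 0 \<le> x $ 2 \<and> x $ 2 < 1 \<and> 0 \<le> x $ 3 \<and> x $ 3 < 1}"

definition periodic_on :: "(real ^ 3) set \<Rightarrow> (real ^ 3 \<Rightarrow> 'b) \<Rightarrow> bool" where
  "periodic_on S f \<longleftrightarrow> (\<forall>x\<in>S. f (x + axis 2 1) = f x \<and> f (x + axis 3 1) = f x)"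

definition L2 :: "(real ^ 3 \<Rightarrow> 'b::euclidean_space) set" where
  "L2 = {f. periodic_on strip f \<and> f \<in> borel_measurable (lebesgue_on cell)
          \<and> integrable (lebesgue_on cell) (\<lambda>x. (norm (f x))\<^sup>2)}"

text \<open>On \<open>real ^ 3 ^ 3\<close> the library's \<open>norm\<close> is the Frobenius norm.\<close>

definition L2_norm :: "(real ^ 3 \<Rightarrow> 'b::euclidean_space) \<Rightarrow> real" where
  "L2_norm f = sqrt (\<integral>x. (norm (f x))\<^sup>2 \<partial>lebesgue_on cell)"

definition classical_partial :: "3 \<Rightarrow> (real ^ 3 \<Rightarrow> real) \<Rightarrow> real ^ 3 \<Rightarrow> real" where
  "classical_partial j f x = frechet_derivative f (at x) (axis j 1)"

primrec C_k :: "nat \<Rightarrow> (real ^ 3 \<Rightarrow> real) \<Rightarrow> bool" where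
  "C_k 0 f \<longleftrightarrow> continuous_on UNIV f"
| "C_k (Suc k) f \<longleftrightarrow> (\<forall>x. f differentiable (at x)) \<and> (\<forall>j. C_k k (classical_partial j f))"

text \<open>
  The restrictions of these functions to the closed domain \<open>[0,1] \<times> \<bbbT>\<^sup>2\<close> are the functions that
  are smooth up to the boundary.
\<close>

definition smooth_periodic :: "(real ^ 3 \<Rightarrow> real) set" where
  "smooth_periodic = {f. (\<forall>k. C_k k f) \<and> periodic_on UNIV f}"

text \<open>
  \<open>C\<^sub>c\<^sup>\<infinity>(\<Omega>)\<close>: as \<open>\<bbbT>\<^sup>2\<close> is compact, the support is a compact subset of \<open>\<Omega>\<close> iff it stays away from
  the two boundary components.
\<close>

definition test_functions :: "(real ^ 3 \<Rightarrow> real) set" where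
  "test_functions = {f \<in> smooth_periodic.
     \<exists>d>0. \<forall>x. x $ 1 \<le> d \<or> 1 - d \<le> x $ 1 \<longrightarrow> f x = 0}"

definition is_weak_partial :: "3 \<Rightarrow> (real ^ 3 \<Rightarrow> real) \<Rightarrow> (real ^ 3 \<Rightarrow> real) \<Rightarrow> bool" where
  "is_weak_partial j f g \<longleftrightarrow>
     (\<forall>\<phi>\<in>test_functions.
        (\<integral>x. f x * classical_partial j \<phi> x \<partial>lebesgue_on cell)
        = - (\<integral>x. g x * \<phi> x \<partial>lebesgue_on cell))"

definition H1 :: "(real ^ 3 \<Rightarrow> real) set" where
  "H1 = {f \<in> L2. \<forall>j. \<exists>g\<in>L2. is_weak_partial j f g}"

text \<open>Weak partial derivatives are determined up to null sets; a representative is chosen.\<close>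

definition weak_partial :: "3 \<Rightarrow> (real ^ 3 \<Rightarrow> real) \<Rightarrow> real ^ 3 \<Rightarrow> real" where
  "weak_partial j f = (SOME g. g \<in> L2 \<and> is_weak_partial j f g)"

definition H1_norm :: "(real ^ 3 \<Rightarrow> real) \<Rightarrow> real" where
  "H1_norm f = sqrt ((L2_norm f)\<^sup>2 + (\<Sum>j\<in>UNIV. (L2_norm (weak_partial j f))\<^sup>2))"

text \<open>
  The boundary \<open>{0,1} \<times> \<bbbT>\<^sup>2\<close> carries the sum of the Lebesgue measures on its two components, each
  of which is parametrised by the unit square.
\<close>

definition boundary_point :: "real \<Rightarrow> real ^ 2 \<Rightarrow> real ^ 3" where
  "boundary_point a y = vector [a, y $ 1, y $ 2]"

definition square :: "(real ^ 2) set" where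
  "square = {y. 0 \<le> y $ 1 \<and> y $ 1 < 1 \<and> 0 \<le> y $ 2 \<and> y $ 2 < 1}"

definition L2_boundary :: "(real ^ 3 \<Rightarrow> real) set" where
  "L2_boundary = {g. periodic_on {x. x $ 1 = 0 \<or> x $ 1 = 1} g \<and>
     (\<forall>a\<in>{0,1}. (\<lambda>y. g (boundary_point a y)) \<in> borel_measurable (lebesgue_on square)
        \<and> integrable (lebesgue_on square) (\<lambda>y. (g (boundary_point a y))\<^sup>2))}"

definition L2_boundary_norm :: "(real ^ 3 \<Rightarrow> real) \<Rightarrow> real" where
  "L2_boundary_norm g =
     sqrt (\<Sum>a\<in>{0,1}. \<integral>y. (g (boundary_point a y))\<^sup>2 \<partial>lebesgue_on square)"

text \<open>
  The trace operator is the continuous extension to \<open>H\<^sup>1(\<Omega>)\<close> of the restriction to the boundary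
  of functions that are smooth up to the boundary; this is its graph.
\<close>

definition has_trace :: "(real ^ 3 \<Rightarrow> real) \<Rightarrow> (real ^ 3 \<Rightarrow> real) \<Rightarrow> bool" where
  "has_trace f g \<longleftrightarrow> f \<in> H1 \<and> g \<in> L2_boundary \<and>
     (\<exists>\<phi> :: nat \<Rightarrow> real ^ 3 \<Rightarrow> real.
        (\<forall>n. \<phi> n \<in> smooth_periodic) \<and>
        (\<lambda>n. H1_norm (\<lambda>x. \<phi> n x - f x)) \<longlonglongrightarrow> 0 \<and>
        (\<lambda>n. L2_boundary_norm (\<lambda>x. \<phi> n x - g x)) \<longlonglongrightarrow> 0)"

text \<open>
  The outward normal is \<open>- axis 1 1\<close> at first coordinate 0 and \<open>axis 1 1\<close> at first coordinate 1, so
  the normal component on the boundary is, up to sign, the trace of the first component.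
\<close>

definition V1 :: "(real ^ 3 \<Rightarrow> real ^ 3) set" where
  "V1 = {u. (\<forall>i. (\<lambda>x. u x $ i) \<in> H1) \<and> has_trace (\<lambda>x. u x $ 1) (\<lambda>x. 0)}"

definition grad :: "(real ^ 3 \<Rightarrow> real ^ 3) \<Rightarrow> real ^ 3 \<Rightarrow> real ^ 3 ^ 3" where
  "grad u x = (\<chi> i j. weak_partial j (\<lambda>y. u y $ i) x)"

definition div_field :: "(real ^ 3 \<Rightarrow> real ^ 3) \<Rightarrow> real ^ 3 \<Rightarrow> real" where
  "div_field u x = (\<Sum>i\<in>UNIV. weak_partial i (\<lambda>y. u y $ i) x)"

end

theory Submission
  imports Defs "HOL-Computational_Algebra.Polynomial"
begin

text \<open>
  Write \<open>G = \<nabla>u\<close> and \<open>t = tr G = div u\<close>. Pointwise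
  \<open>\<bar>G + G\<^sup>T - (2/3) t I\<bar>\<^sup>2 / 2 = \<bar>G\<bar>\<^sup>2 + G : G\<^sup>T - (2/3) t\<^sup>2\<close>
  (\<open>half_norm_deviatoric_square\<close>), so the inequality follows, with \<open>\<integral> t\<^sup>2 / 3\<close> to spare, from
  \<open>\<integral> G : G\<^sup>T = \<integral> t\<^sup>2\<close>. This identity is the sum over \<open>i < j\<close> of
  \<open>\<integral> \<partial>\<^sub>j u\<^sub>i \<partial>\<^sub>i u\<^sub>j = \<integral> \<partial>\<^sub>i u\<^sub>i \<partial>\<^sub>j u\<^sub>j\<close>. For smooth fields it is a double integration by
  parts: no boundary terms arise, because in each pair \<open>j\<close> is a periodic direction and
  \<open>u\<^sub>1\<close> vanishes on the boundary. What needs an argument is that \<open>u\<close> is only in \<open>H\<^sup>1\<close>, so that second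
  derivatives are not available.

  The second derivative in a periodic direction is replaced by a derivative with respect to a
  translation parameter. If \<open>v\<close> has the weak partial derivative \<open>h\<close> in a tangential direction \<open>j\<close>,
  then \<open>s \<mapsto> \<integral> w(x) v(x + s e\<^sub>j) dx\<close> is differentiable with derivative \<open>\<integral> w(x) h(x + s e\<^sub>j) dx\<close> for
  every square integrable \<open>w\<close> (\<open>shift_pairing_deriv\<close>): for a test function \<open>w\<close> this is the
  definition of \<open>h\<close>, and the general case follows because test functions are dense in \<open>L\<^sup>2\<close>
  (\<open>square_integrable_approximable\<close>) and the derivatives converge uniformly in \<open>s\<close>. Suppose now
  that \<open>u\<close> and all \<open>v\<close> satisfy \<open>\<integral> \<partial>\<^sub>i u v = - \<integral> u \<partial>\<^sub>i v\<close>. Apply this to the translates of \<open>v\<close>, move the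
  translation to \<open>u\<close> on the right-hand side, and differentiate at \<open>s = 0\<close>: the result is
  \<open>\<integral> \<partial>\<^sub>i u \<partial>\<^sub>j v = \<integral> \<partial>\<^sub>j u \<partial>\<^sub>i v\<close> (\<open>exchange_derivatives\<close>).

  The required integration by parts for two \<open>H\<^sup>1\<close> functions is, in a tangential direction, another
  consequence of the differentiation formula, since the same pairing can be differentiated through
  either factor (\<open>tangential_integration_by_parts\<close>). In the normal direction one factor \<open>f\<close> has zero
  trace (\<open>normal_integration_by_parts\<close>). There \<open>f\<close> is multiplied by a cutoff \<open>\<theta>\<close> that vanishes near
  the boundary, and the error \<open>\<integral> \<theta>' f v\<close> has to disappear as \<open>\<theta>\<close> tends to 1. With
  \<open>\<tau> = x\<^sub>1 (1 - x\<^sub>1)\<close> one has \<open>\<bar>\<theta>'\<bar> \<le> 2 / \<tau>\<close>, and Hardy's inequality says that \<open>f / \<tau>\<close> is square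
  integrable (\<open>Hardy_zero_trace\<close>), so dominated convergence applies.
\<close>

section \<open>Square integrable functions and convergence in mean square\<close>

definition square_integrable :: "'a measure \<Rightarrow> ('a \<Rightarrow> real) \<Rightarrow> bool" where
  "square_integrable M f \<longleftrightarrow> f \<in> borel_measurable M \<and> integrable M (\<lambda>x. (f x)\<^sup>2)"

lemma square_integrable_mult:
  assumes "square_integrable M f" "square_integrable M g"
  shows "integrable M (\<lambda>x. f x * g x)"
proof (rule Bochner_Integration.integrable_bound[where f = "\<lambda>x. (f x)\<^sup>2 + (g x)\<^sup>2"])
  show "AE x in M. norm (f x * g x) \<le> norm ((f x)\<^sup>2 + (g x)\<^sup>2)"
  proof (rule AE_I2)
    fix x
    have "2 * \<bar>f x * g x\<bar> \<le> (f x)\<^sup>2 + (g x)\<^sup>2"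
      using sum_squares_bound[of "\<bar>f x\<bar>" "\<bar>g x\<bar>"] by (simp add: abs_mult)
    then show "norm (f x * g x) \<le> norm ((f x)\<^sup>2 + (g x)\<^sup>2)" by simp
  qed
qed (use assms in \<open>auto simp: square_integrable_def\<close>)

lemma square_integrable_add:
  assumes "square_integrable M f" "square_integrable M g"
  shows "square_integrable M (\<lambda>x. f x + g x)"
  using assms square_integrable_mult[OF assms]
  by (auto simp: square_integrable_def power2_sum mult.assoc)

lemma square_integrable_cmult:
  assumes "square_integrable M f"
  shows "square_integrable M (\<lambda>x. c * f x)"
  using assms by (auto simp: square_integrable_def power_mult_distrib)

lemma square_integrable_diff:
  assumes "square_integrable M f" "square_integrable M g"
  shows "square_integrable M (\<lambda>x. f x - g x)"
  using square_integrable_add[OF assms(1) square_integrable_cmult[OF assms(2), of "-1"]] by simp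

lemma square_integrable_bounded_mult:
  assumes "square_integrable M f" "w \<in> borel_measurable M" "AE x in M. \<bar>w x\<bar> \<le> C"
  shows "square_integrable M (\<lambda>x. w x * f x)"
  unfolding square_integrable_def
proof
  show "integrable M (\<lambda>x. (w x * f x)\<^sup>2)"
  proof (rule Bochner_Integration.integrable_bound[where f = "\<lambda>x. C\<^sup>2 * (f x)\<^sup>2"])
    show "AE x in M. norm ((w x * f x)\<^sup>2) \<le> norm (C\<^sup>2 * (f x)\<^sup>2)"
      using assms(3) by eventually_elim
        (auto simp: power_mult_distrib intro!: mult_right_mono abs_le_square_iff[THEN iffD1])
  qed (use assms in \<open>auto simp: square_integrable_def\<close>)
qed (use assms in \<open>auto simp: square_integrable_def\<close>)

text \<open>
  The quadratic form \<open>(a, b) \<mapsto> \<integral> (a f + b g)\<^sup>2\<close> is nonnegative, so its discriminant is not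
  positive. The degenerate case \<open>\<integral> f\<^sup>2 = 0\<close> is separate because the general choice of \<open>(a, b)\<close> then
  gives no information.
\<close>

lemma Cauchy_Schwarz_integral:
  assumes "square_integrable M f" "square_integrable M g"
  shows "\<bar>\<integral>x. f x * g x \<partial>M\<bar> \<le> sqrt (\<integral>x. (f x)\<^sup>2 \<partial>M) * sqrt (\<integral>x. (g x)\<^sup>2 \<partial>M)"
proof -
  let ?A = "\<integral>x. (f x)\<^sup>2 \<partial>M" and ?B = "\<integral>x. (g x)\<^sup>2 \<partial>M" and ?P = "\<integral>x. f x * g x \<partial>M"
  have i: "integrable M (\<lambda>x. (f x)\<^sup>2)" "integrable M (\<lambda>x. (g x)\<^sup>2)" "integrable M (\<lambda>x. f x * g x)"
    using assms square_integrable_mult[OF assms] by (auto simp: square_integrable_def)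
  have nn: "0 \<le> a\<^sup>2 * ?A + 2 * a * b * ?P + b\<^sup>2 * ?B" for a b
  proof -
    have "0 \<le> (\<integral>x. (a * f x + b * g x)\<^sup>2 \<partial>M)" by (intro integral_nonneg_AE) auto
    also have "\<dots> = (\<integral>x. a\<^sup>2 * (f x)\<^sup>2 + 2 * a * b * (f x * g x) + b\<^sup>2 * (g x)\<^sup>2 \<partial>M)"
      by (intro Bochner_Integration.integral_cong) (auto simp: power2_eq_square algebra_simps)
    also have "\<dots> = a\<^sup>2 * ?A + 2 * a * b * ?P + b\<^sup>2 * ?B" using i by simp
    finally show ?thesis .
  qed
  have A: "0 \<le> ?A" and B: "0 \<le> ?B" by (auto intro: integral_nonneg_AE)
  have "?P\<^sup>2 \<le> ?A * ?B"
  proof (cases "?A = 0")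
    case True
    have "0 \<le> 2 * a * ?P + ?B" for a using nn[of a 1] True by simp
    \<comment> \<open>An affine function of \<open>a\<close> that is bounded below is constant.\<close>
    from this[of "- (?B + 1) / (2 * ?P)"] have "?P = 0" by (cases "?P = 0") (auto simp: field_simps)
    then show ?thesis using True by simp
  next
    case False
    then have pos: "?A > 0" using A by linarith
    \<comment> \<open>\<open>a = - P\<close>, \<open>b = A\<close> is a multiple of the minimiser of the quadratic form at \<open>b = 1\<close>.\<close>
    have "0 \<le> ?A * (?A * ?B - ?P\<^sup>2)"
      using nn[of "- ?P" "?A"] by (simp add: power2_eq_square algebra_simps)
    then show ?thesis using pos by (simp add: zero_le_mult_iff)
  qed
  then have "sqrt (?P\<^sup>2) \<le> sqrt (?A * ?B)" by (rule real_sqrt_le_mono)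
  then show ?thesis by (simp add: real_sqrt_mult)
qed

definition L2_tendsto :: "'a measure \<Rightarrow> (nat \<Rightarrow> 'a \<Rightarrow> real) \<Rightarrow> ('a \<Rightarrow> real) \<Rightarrow> bool" where
  "L2_tendsto M F f \<longleftrightarrow> square_integrable M f \<and> (\<forall>n. square_integrable M (F n)) \<and>
     (\<lambda>n. \<integral>x. (F n x - f x)\<^sup>2 \<partial>M) \<longlonglongrightarrow> 0"

text \<open>
  The bound is kept explicit because it is used with translated functions \<open>g\<close>, whose norms do not
  depend on the translation: the convergence of the pairings is then uniform in the translation.
\<close>

lemma L2_tendsto_pairing_error:
  assumes "L2_tendsto M F f" "square_integrable M g"
  shows "\<bar>(\<integral>x. F n x * g x \<partial>M) - (\<integral>x. f x * g x \<partial>M)\<bar>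
    \<le> sqrt (\<integral>x. (F n x - f x)\<^sup>2 \<partial>M) * sqrt (\<integral>x. (g x)\<^sup>2 \<partial>M)"
proof -
  have s: "square_integrable M (F n)" "square_integrable M f" using assms by (auto simp: L2_tendsto_def)
  have "(\<integral>x. F n x * g x \<partial>M) - (\<integral>x. f x * g x \<partial>M) = (\<integral>x. (F n x - f x) * g x \<partial>M)"
    by (simp add: left_diff_distrib square_integrable_mult s assms)
  then show ?thesis using Cauchy_Schwarz_integral[OF square_integrable_diff[OF s] assms(2)] by simp
qed

lemma L2_tendsto_pairing:
  assumes "L2_tendsto M F f" "square_integrable M g"
  shows "(\<lambda>n. \<integral>x. F n x * g x \<partial>M) \<longlonglongrightarrow> (\<integral>x. f x * g x \<partial>M)"
proof (rule LIM_zero_cancel, rule Lim_null_comparison)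
  show "\<forall>\<^sub>F n in sequentially. norm ((\<integral>x. F n x * g x \<partial>M) - (\<integral>x. f x * g x \<partial>M))
      \<le> sqrt (\<integral>x. (F n x - f x)\<^sup>2 \<partial>M) * sqrt (\<integral>x. (g x)\<^sup>2 \<partial>M)"
    using L2_tendsto_pairing_error[OF assms] by simp
  have "(\<lambda>n. sqrt (\<integral>x. (F n x - f x)\<^sup>2 \<partial>M)) \<longlonglongrightarrow> sqrt 0"
    by (intro tendsto_real_sqrt) (use assms in \<open>simp add: L2_tendsto_def\<close>)
  then show "(\<lambda>n. sqrt (\<integral>x. (F n x - f x)\<^sup>2 \<partial>M) * sqrt (\<integral>x. (g x)\<^sup>2 \<partial>M)) \<longlonglongrightarrow> 0"
    by (auto intro: tendsto_mult_left_zero)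
qed

lemma L2_tendsto_bounded_mult:
  assumes "L2_tendsto M F f" "w \<in> borel_measurable M" "AE x in M. \<bar>w x\<bar> \<le> C"
  shows "L2_tendsto M (\<lambda>n x. w x * F n x) (\<lambda>x. w x * f x)"
proof -
  have s: "square_integrable M (F n)" "square_integrable M f" for n
    using assms by (auto simp: L2_tendsto_def)
  have sd: "square_integrable M (\<lambda>x. F n x - f x)" for n
    by (intro square_integrable_diff s)
  have le: "(\<integral>x. (w x * F n x - w x * f x)\<^sup>2 \<partial>M) \<le> C\<^sup>2 * (\<integral>x. (F n x - f x)\<^sup>2 \<partial>M)" for n
  proof -
    have "(\<integral>x. (w x * F n x - w x * f x)\<^sup>2 \<partial>M) = (\<integral>x. (w x * (F n x - f x))\<^sup>2 \<partial>M)"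
      by (simp add: right_diff_distrib)
    also have "\<dots> \<le> (\<integral>x. C\<^sup>2 * (F n x - f x)\<^sup>2 \<partial>M)"
    proof (rule integral_mono_AE)
      show "AE x in M. (w x * (F n x - f x))\<^sup>2 \<le> C\<^sup>2 * (F n x - f x)\<^sup>2"
        using assms(3) by eventually_elim
          (auto simp: power_mult_distrib intro!: mult_right_mono abs_le_square_iff[THEN iffD1])
    qed (use sd[of n] square_integrable_bounded_mult[OF sd[of n] assms(2,3)] in
        \<open>auto simp: square_integrable_def\<close>)
    finally show ?thesis by simp
  qed
  have "(\<lambda>n. C\<^sup>2 * (\<integral>x. (F n x - f x)\<^sup>2 \<partial>M)) \<longlonglongrightarrow> 0"
    using assms(1) by (auto simp: L2_tendsto_def intro: tendsto_mult_right_zero)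
  then have "(\<lambda>n. \<integral>x. (w x * F n x - w x * f x)\<^sup>2 \<partial>M) \<longlonglongrightarrow> 0"
    by (rule tendsto_sandwich[OF _ _ tendsto_const, rotated 2])
      (auto intro!: always_eventually integral_nonneg_AE le)
  then show ?thesis
    using s square_integrable_bounded_mult[OF _ assms(2,3)] by (auto simp: L2_tendsto_def)
qed

lemma L2_tendsto_square:
  assumes "L2_tendsto M F f"
  shows "(\<lambda>n. \<integral>x. (F n x)\<^sup>2 \<partial>M) \<longlonglongrightarrow> (\<integral>x. (f x)\<^sup>2 \<partial>M)"
proof -
  have s: "square_integrable M (F n)" "square_integrable M f" for n
    using assms by (auto simp: L2_tendsto_def)
  have "(\<integral>x. (F n x)\<^sup>2 \<partial>M)
      = (\<integral>x. (F n x - f x)\<^sup>2 \<partial>M) + 2 * (\<integral>x. F n x * f x \<partial>M) - (\<integral>x. (f x)\<^sup>2 \<partial>M)" for n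
  proof -
    have "(\<integral>x. (F n x)\<^sup>2 \<partial>M) = (\<integral>x. (F n x - f x)\<^sup>2 + 2 * (F n x * f x) - (f x)\<^sup>2 \<partial>M)"
      by (intro Bochner_Integration.integral_cong) (auto simp: power2_eq_square algebra_simps)
    then show ?thesis
      using s square_integrable_mult[OF s(1)[of n] s(2)] square_integrable_diff[OF s(1)[of n] s(2)]
      by (simp add: square_integrable_def)
  qed
  moreover have "(\<lambda>n. (\<integral>x. (F n x - f x)\<^sup>2 \<partial>M) + 2 * (\<integral>x. F n x * f x \<partial>M) - (\<integral>x. (f x)\<^sup>2 \<partial>M))
      \<longlonglongrightarrow> 0 + 2 * (\<integral>x. f x * f x \<partial>M) - (\<integral>x. (f x)\<^sup>2 \<partial>M)"
    by (intro tendsto_intros L2_tendsto_pairing assms s) (use assms in \<open>simp add: L2_tendsto_def\<close>)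
  ultimately show ?thesis by (simp add: power2_eq_square)
qed

lemma L2_tendsto_dominated:
  assumes "\<And>n. F n \<in> borel_measurable M" "f \<in> borel_measurable M"
    and "integrable M (\<lambda>x. (w x)\<^sup>2)"
    and bound: "\<And>n. AE x in M. \<bar>F n x\<bar> \<le> w x"
    and lim: "AE x in M. (\<lambda>n. F n x) \<longlonglongrightarrow> f x"
  shows "L2_tendsto M F f"
proof -
  have fw: "AE x in M. \<bar>f x\<bar> \<le> w x"
  proof -
    have "AE x in M. \<forall>n. \<bar>F n x\<bar> \<le> w x" using bound by (simp add: AE_all_countable)
    then show ?thesis using lim
      by eventually_elim (rule LIMSEQ_le_const2[OF tendsto_rabs], auto)
  qed
  have sq: "square_integrable M h" if "h \<in> borel_measurable M" "AE x in M. \<bar>h x\<bar> \<le> w x" for h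
    unfolding square_integrable_def
  proof
    show "integrable M (\<lambda>x. (h x)\<^sup>2)"
      by (rule Bochner_Integration.integrable_bound[OF assms(3)])
        (use that in \<open>auto simp: abs_le_square_iff[symmetric] elim!: eventually_mono\<close>)
  qed (rule that)
  have "(\<lambda>n. \<integral>x. (F n x - f x)\<^sup>2 \<partial>M) \<longlonglongrightarrow> (\<integral>x. 0 \<partial>M)"
  proof (rule integral_dominated_convergence[where w = "\<lambda>x. 4 * (w x)\<^sup>2"])
    show "AE x in M. (\<lambda>n. (F n x - f x)\<^sup>2) \<longlonglongrightarrow> 0"
      using lim by eventually_elim (rule tendsto_eq_intros LIM_zero | simp)+
    show "AE x in M. norm ((F n x - f x)\<^sup>2) \<le> 4 * (w x)\<^sup>2" for n
      using bound[of n] fw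
    proof eventually_elim
      case (elim x)
      then have "\<bar>F n x - f x\<bar> \<le> \<bar>2 * w x\<bar>" by simp
      then have "(F n x - f x)\<^sup>2 \<le> (2 * w x)\<^sup>2" by (simp only: abs_le_square_iff)
      then show ?case by simp
    qed
  qed (use assms in auto)
  then show ?thesis using sq[OF assms(1) bound] sq[OF assms(2) fw] by (simp add: L2_tendsto_def)
qed

section \<open>Smooth functions\<close>

lemma C_k_lower: "C_k (Suc k) f \<Longrightarrow> C_k k f"
proof (induction k arbitrary: f)
  case 0
  then show ?case
    by (simp add: continuous_at_imp_continuous_on differentiable_imp_continuous_within)
qed auto

lemma C_k_continuous: "C_k k f \<Longrightarrow> continuous_on UNIV f"
  by (induction k) (auto simp: continuous_at_imp_continuous_on differentiable_imp_continuous_within)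

lemma classical_partial_eq:
  assumes "(f has_derivative f') (at x)"
  shows "classical_partial j f x = f' (axis j 1)"
  using frechet_derivative_at[OF assms] by (simp add: classical_partial_def)

lemma has_derivative_frechet:
  assumes "f differentiable (at x)"
  shows "(f has_derivative frechet_derivative f (at x)) (at x)"
  using assms frechet_derivative_works by blast

lemma classical_partial_add:
  assumes "\<And>x. f differentiable (at x)" "\<And>x. g differentiable (at x)"
  shows "classical_partial j (\<lambda>x. f x + g x) = (\<lambda>x. classical_partial j f x + classical_partial j g x)"
  by (rule ext, subst classical_partial_eq[OF has_derivative_add[OF
        has_derivative_frechet[OF assms(1)] has_derivative_frechet[OF assms(2)]]])
    (simp add: classical_partial_def)

lemma classical_partial_mult:
  assumes "\<And>x. f differentiable (at x)" "\<And>x. g differentiable (at x)"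
  shows "classical_partial j (\<lambda>x. f x * g x)
    = (\<lambda>x. f x * classical_partial j g x + classical_partial j f x * g x)"
  by (rule ext, subst classical_partial_eq[OF has_derivative_mult[OF
        has_derivative_frechet[OF assms(1)] has_derivative_frechet[OF assms(2)]]])
    (simp add: classical_partial_def)

lemma classical_partial_compose:
  fixes f :: "real ^ 3 \<Rightarrow> real"
  assumes "f differentiable (at x)" "(g has_real_derivative g') (at (f x))"
  shows "classical_partial j (\<lambda>x. g (f x)) x = g' * classical_partial j f x"
proof -
  have "((\<lambda>x. g (f x)) has_derivative (\<lambda>h. g' * frechet_derivative f (at x) h)) (at x)"
    using has_derivative_compose[OF has_derivative_frechet[OF assms(1)],
        OF assms(2)[unfolded has_field_derivative_def]] .
  from classical_partial_eq[OF this] show ?thesis by (simp add: classical_partial_def)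
qed

lemma C_k_const: "C_k k (\<lambda>x. c)"
proof (induction k arbitrary: c)
  case (Suc k)
  have "classical_partial j (\<lambda>x. c) = (\<lambda>x. 0)" for j
    by (rule ext, subst classical_partial_eq[OF has_derivative_const]) simp
  then show ?case using Suc by simp
qed simp

lemma C_k_coordinate: "C_k k (\<lambda>x. x $ i)"
proof (cases k)
  case (Suc m)
  have d: "((\<lambda>x. x $ i) has_derivative (\<lambda>h. h $ i)) (at x)" for x :: "real ^ 3"
    by (intro bounded_linear_imp_has_derivative bounded_linear_vec_nth)
  have "classical_partial j (\<lambda>x. x $ i) = (\<lambda>x. axis j 1 $ i)" for j
    by (rule ext) (rule classical_partial_eq[OF d])
  then show ?thesis using d C_k_const by (auto simp: Suc differentiable_def)
qed (simp add: continuous_on_component)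

lemma C_k_add: "C_k k f \<Longrightarrow> C_k k g \<Longrightarrow> C_k k (\<lambda>x. f x + g x)"
proof (induction k arbitrary: f g)
  case (Suc k)
  then show ?case by (simp add: classical_partial_add)
qed (simp add: continuous_on_add)

lemma C_k_mult: "C_k k f \<Longrightarrow> C_k k g \<Longrightarrow> C_k k (\<lambda>x. f x * g x)"
proof (induction k arbitrary: f g)
  case (Suc k)
  have "C_k k f" "C_k k g" using Suc.prems C_k_lower by blast+
  then show ?case using Suc by (simp add: classical_partial_mult C_k_add)
qed (simp add: continuous_on_mult)

text \<open>
  A set of functions of one variable that is closed under differentiation consists of smooth
  functions, so composing with one of its members preserves \<open>C_k\<close>. This form is convenient for
  families such as \<open>p(1/t) exp(-1/t)\<close> with varying polynomial \<open>p\<close>, whose derivatives stay in the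
  family but are tedious to enumerate.
\<close>

lemma C_k_compose:
  assumes closed: "\<And>g. g \<in> S \<Longrightarrow> \<exists>g'\<in>S. \<forall>t. (g has_real_derivative g' t) (at t)"
    and "g \<in> S" "C_k k f"
  shows "C_k k (\<lambda>x. g (f x))"
  using assms(2,3)
proof (induction k arbitrary: g f)
  case 0
  from closed[OF 0(1)] have "continuous_on UNIV g"
    by (auto intro!: continuous_at_imp_continuous_on DERIV_isCont)
  then show ?case using 0 by (auto intro: continuous_on_compose2)
next
  case (Suc k)
  obtain g' where g': "g' \<in> S" "\<And>t. (g has_real_derivative g' t) (at t)"
    using closed[OF Suc.prems(1)] by blast
  have "C_k k f" using Suc.prems C_k_lower by blast
  moreover have "classical_partial j (\<lambda>x. g (f x)) = (\<lambda>x. g' (f x) * classical_partial j f x)" for j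
    by (rule ext) (rule classical_partial_compose[OF _ g'(2)], use Suc.prems in simp)
  moreover have "(\<lambda>x. g (f x)) differentiable (at x)" for x
    using differentiable_compose[of g f x] g'(2)[of "f x"] Suc.prems
    by (auto simp: real_differentiable_def)
  ultimately show ?case using Suc g'(1) by (simp add: C_k_mult)
qed

lemma classical_partial_shift:
  assumes "\<And>x. f differentiable (at x)"
  shows "classical_partial j (\<lambda>x. f (x + a)) = (\<lambda>x. classical_partial j f (x + a))"
proof
  fix x
  have "((\<lambda>x. f (x + a)) has_derivative (\<lambda>h. frechet_derivative f (at (x + a)) h)) (at x)"
    by (rule has_derivative_compose[where f = "\<lambda>x. x + a" and f' = "\<lambda>h. h"])
      (auto intro!: derivative_eq_intros has_derivative_frechet assms)
  from classical_partial_eq[OF this]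
  show "classical_partial j (\<lambda>x. f (x + a)) x = classical_partial j f (x + a)"
    by (simp add: classical_partial_def)
qed

lemma C_k_shift: "C_k k f \<Longrightarrow> C_k k (\<lambda>x. f (x + a))"
proof (induction k arbitrary: f)
  case 0
  then show ?case by (auto intro!: continuous_on_compose2[of UNIV f] continuous_intros)
next
  case (Suc k)
  have "(\<lambda>x. f (x + a)) differentiable (at x)" for x
    by (rule differentiable_compose[of f "\<lambda>x. x + a"]) (use Suc.prems in \<open>auto intro: derivative_intros\<close>)
  then show ?case using Suc by (simp add: classical_partial_shift)
qed

text \<open>
  The functions \<open>p(1/t) exp(-1/t)\<close>, extended by zero to \<open>t \<le> 0\<close>. The case \<open>p = 1\<close> is the standard
  smooth function that vanishes exactly on a half line; general \<open>p\<close> is admitted because the family is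
  then closed under differentiation.
\<close>

definition poly_exp :: "real poly \<Rightarrow> real \<Rightarrow> real" where
  "poly_exp p t = (if t > 0 then poly p (1 / t) * exp (- (1 / t)) else 0)"

lemma poly_over_exp_tendsto_0: "((\<lambda>x. poly p x / exp x) \<longlongrightarrow> (0::real)) at_top"
proof -
  have "((\<lambda>x. \<Sum>i\<le>degree p. coeff p i * (x ^ i / exp x)) \<longlongrightarrow> (\<Sum>i\<le>degree p. coeff p i * 0)) at_top"
    by (intro tendsto_intros tendsto_power_div_exp_0)
  then show ?thesis by (simp add: poly_altdef sum_divide_distrib)
qed

text \<open>
  With \<open>r = 1/t\<close> and \<open>dr/dt = - r\<^sup>2\<close>, the derivative of \<open>p(r) exp(- r)\<close> is
  \<open>r\<^sup>2 (p(r) - p'(r)) exp(- r)\<close>. At \<open>t = 0\<close> the difference quotient from the right is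
  \<open>r p(r) exp(- r)\<close>, which tends to zero as \<open>r\<close> tends to infinity.
\<close>

lemma poly_exp_deriv:
  "(poly_exp p has_real_derivative poly_exp ([:0, 0, 1:] * (p - pderiv p)) t) (at t)"
proof -
  consider "t > 0" | "t < 0" | "t = 0" by linarith
  then show ?thesis
  proof cases
    case 1
    have "((\<lambda>t. poly p (1 / t) * exp (- (1 / t))) has_real_derivative
        poly_exp ([:0, 0, 1:] * (p - pderiv p)) t) (at t)"
      using 1 by (auto intro!: derivative_eq_intros DERIV_chain2[where f = "poly p"] poly_DERIV
          simp: poly_exp_def field_simps power2_eq_square)
    then show ?thesis
      by (rule has_field_derivative_transform_within_open[of _ _ _ "{0<..}"]) (use 1 in \<open>auto simp: poly_exp_def\<close>)
  next
    case 2
    have "((\<lambda>t. 0) has_real_derivative poly_exp ([:0, 0, 1:] * (p - pderiv p)) t) (at t)"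
      using 2 by (simp add: poly_exp_def)
    then show ?thesis
      by (rule has_field_derivative_transform_within_open[of _ _ _ "{..<0}"]) (use 2 in \<open>auto simp: poly_exp_def\<close>)
  next
    case 3
    have "((\<lambda>h. poly_exp p h / h) \<longlongrightarrow> 0) (at_left 0)"
      by (rule Lim_transform_eventually[OF tendsto_const])
        (auto simp: eventually_at_left_field poly_exp_def intro!: exI[of _ "-1"])
    moreover have "((\<lambda>h. poly_exp p h / h) \<longlongrightarrow> 0) (at_right 0)"
    proof (rule Lim_transform_eventually)
      show "((\<lambda>h. poly (pCons 0 p) (inverse h) / exp (inverse h)) \<longlongrightarrow> 0) (at_right (0::real))"
        by (rule filterlim_compose[OF poly_over_exp_tendsto_0 filterlim_inverse_at_top_right])
      show "\<forall>\<^sub>F h in at_right 0. poly (pCons 0 p) (inverse h) / exp (inverse h) = poly_exp p h / h"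
        by (auto simp: eventually_at_right_field poly_exp_def exp_minus field_simps intro!: exI[of _ 1])
    qed
    ultimately have "((\<lambda>h. poly_exp p h / h) \<longlongrightarrow> 0) (at 0)"
      by (simp add: filterlim_at_split)
    then show ?thesis using 3 by (simp add: DERIV_def poly_exp_def)
  qed
qed

abbreviation flat :: "real \<Rightarrow> real" where
  "flat \<equiv> poly_exp 1"

lemma flat_eq: "flat t = (if t > 0 then exp (- (1 / t)) else 0)"
  by (simp add: poly_exp_def)

lemma flat_pos_iff: "flat t > 0 \<longleftrightarrow> t > 0" and flat_nonneg: "flat t \<ge> 0" and flat_le_1: "flat t \<le> 1"
  by (auto simp: flat_eq)

lemma C_k_flat: "C_k k f \<Longrightarrow> C_k k (\<lambda>x. flat (f x))"
  by (rule C_k_compose[where S = "range poly_exp"]) (use poly_exp_deriv in blast)+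

lemma C_k_sin: "C_k k f \<Longrightarrow> C_k k (\<lambda>x. sin (f x))"
proof (rule C_k_compose[where S = "range (\<lambda>c t. sin (t + c))" and g = sin])
  show "sin \<in> range (\<lambda>c t. sin (t + c :: real))" by (rule range_eqI[of _ _ 0]) simp
  fix g :: "real \<Rightarrow> real" assume "g \<in> range (\<lambda>c t. sin (t + c))"
  then obtain c where c: "g = (\<lambda>t. sin (t + c))" by auto
  have "(g has_real_derivative sin (t + (c + pi / 2))) (at t)" for t
    \<comment> \<open>The cosine is a shifted sine, so the shifts of the sine are closed under differentiation.\<close>
    unfolding c by (auto intro!: derivative_eq_intros simp: sin_add cos_add)
  then show "\<exists>g'\<in>range (\<lambda>c t. sin (t + c)). \<forall>t. (g has_real_derivative g' t) (at t)"
    by (intro bexI[of _ "\<lambda>t. sin (t + (c + pi / 2))"]) auto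
qed

lemma C_k_exp: "C_k k f \<Longrightarrow> C_k k (\<lambda>x. exp (f x))"
  by (rule C_k_compose[where S = "{exp}"]) (auto intro: DERIV_exp)

lemma C_k_cmult: "C_k k f \<Longrightarrow> C_k k (\<lambda>x. c * f x)"
  by (intro C_k_mult C_k_const)

lemma C_k_diff: "C_k k f \<Longrightarrow> C_k k g \<Longrightarrow> C_k k (\<lambda>x. f x - g x)"
  using C_k_add[OF _ C_k_cmult[of k g "-1"]] by simp

lemmas C_k_intros = C_k_const C_k_coordinate C_k_add C_k_diff C_k_mult C_k_flat C_k_sin C_k_exp

lemma continuous_partial:
  assumes "C_k 1 f" shows "continuous_on UNIV (classical_partial j f)"
  using assms by simp

lemma line_derivative:
  assumes "f differentiable (at (x + t *\<^sub>R axis j 1))"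
  shows "((\<lambda>s. f (x + s *\<^sub>R axis j 1)) has_real_derivative
    classical_partial j f (x + t *\<^sub>R axis j 1)) (at t)"
proof -
  have "((\<lambda>s. f (x + s *\<^sub>R axis j 1)) has_derivative
      (\<lambda>h. frechet_derivative f (at (x + t *\<^sub>R axis j 1)) (h *\<^sub>R axis j 1))) (at t)"
    by (rule has_derivative_compose[where f = "\<lambda>s. x + s *\<^sub>R axis j 1" and f' = "\<lambda>h. h *\<^sub>R axis j 1"])
      (auto intro!: derivative_eq_intros has_derivative_frechet assms)
  moreover have "frechet_derivative f (at (x + t *\<^sub>R axis j 1)) (h *\<^sub>R axis j 1)
      = classical_partial j f (x + t *\<^sub>R axis j 1) * h" for h
    using linear_frechet_derivative[OF assms] by (simp add: linear_cmul classical_partial_def)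
  ultimately show ?thesis by (simp add: has_field_derivative_def)
qed

section \<open>The periodic cell and test functions\<close>

abbreviation cell_measure :: "(real ^ 3) measure" ("\<mu>") where
  "\<mu> \<equiv> lebesgue_on cell"

lemma cell_subset: "cell \<subseteq> cbox 0 1"
  by (auto simp: cell_def mem_box_cart forall_3)

lemma cell_borel: "cell \<in> sets borel"
  unfolding cell_def by measurable

lemma cell_lebesgue: "cell \<in> sets lebesgue"
  using cell_borel by (simp add: sets_completionI_sets)

lemma cell_lmeasurable: "cell \<in> lmeasurable"
  by (rule fmeasurableI2[OF lmeasurable_cbox cell_subset cell_lebesgue])

interpretation cell: finite_measure \<mu>
  by (rule finite_measure_lebesgue_on[OF cell_lmeasurable])

lemma borel_measurable_cell: "f \<in> borel_measurable borel \<Longrightarrow> f \<in> borel_measurable \<mu>"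
  by (rule measurable_restrict_space1, rule measurable_completion) simp

lemma continuous_cell_measurable:
  fixes f :: "real ^ 3 \<Rightarrow> real"
  assumes "continuous_on (cbox 0 1) f"
  shows "f \<in> borel_measurable \<mu>"
  by (rule continuous_imp_measurable_on_sets_lebesgue[OF continuous_on_subset[OF assms cell_subset] cell_lebesgue])

lemma continuous_cell_bounded:
  fixes f :: "real ^ 3 \<Rightarrow> real"
  assumes "continuous_on (cbox 0 1) f"
  obtains C where "\<And>x. x \<in> cell \<Longrightarrow> \<bar>f x\<bar> \<le> C"
proof -
  have "bounded (f ` cbox 0 1)"
    by (intro compact_imp_bounded compact_continuous_image assms compact_cbox)
  then obtain C where "\<forall>y\<in>f ` cbox 0 1. norm y \<le> C" by (auto simp: bounded_iff)
  then show thesis using cell_subset by (intro that[of C]) auto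
qed

lemma continuous_square_integrable:
  assumes "continuous_on (cbox 0 1) f"
  shows "square_integrable \<mu> f"
proof -
  obtain C where C: "\<And>x. x \<in> cell \<Longrightarrow> \<bar>f x\<bar> \<le> C" using continuous_cell_bounded[OF assms] by metis
  have one: "square_integrable \<mu> (\<lambda>x. 1)" by (simp add: square_integrable_def)
  have "AE x in \<mu>. \<bar>f x\<bar> \<le> C" by (rule AE_I2) (simp add: C)
  then show ?thesis
    using square_integrable_bounded_mult[OF one continuous_cell_measurable[OF assms], of C] by simp
qed

lemma square_integrable_cell_integrable: "square_integrable \<mu> f \<Longrightarrow> integrable \<mu> f"
  using square_integrable_mult[of \<mu> f "\<lambda>x. 1"] by (simp add: square_integrable_def)

lemma smooth_periodic_C_k: "f \<in> smooth_periodic \<Longrightarrow> C_k k f"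
  by (simp add: smooth_periodic_def)

lemma test_function_smooth: "f \<in> test_functions \<Longrightarrow> f \<in> smooth_periodic"
  by (simp add: test_functions_def)

lemma smooth_square_integrable: "C_k 1 f \<Longrightarrow> square_integrable \<mu> f"
  "C_k 1 f \<Longrightarrow> square_integrable \<mu> (classical_partial j f)"
  by (rule continuous_square_integrable, rule continuous_on_subset[OF C_k_continuous subset_UNIV], assumption)
    (rule continuous_square_integrable, rule continuous_on_subset[OF continuous_partial subset_UNIV])

lemma test_square_integrable:
  assumes "f \<in> test_functions"
  shows "square_integrable \<mu> f" "square_integrable \<mu> (classical_partial j f)"
  by (rule smooth_square_integrable[OF smooth_periodic_C_k[OF test_function_smooth[OF assms]]])+

lemma zero_test_function: "(\<lambda>x. 0) \<in> test_functions"
  by (auto simp: test_functions_def smooth_periodic_def periodic_on_def C_k_const intro: exI[of _ 1])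

lemma test_function_cmult: "f \<in> test_functions \<Longrightarrow> (\<lambda>x. c * f x) \<in> test_functions"
  by (auto simp: test_functions_def smooth_periodic_def periodic_on_def C_k_cmult)

lemma test_function_add:
  assumes "f \<in> test_functions" "g \<in> test_functions"
  shows "(\<lambda>x. f x + g x) \<in> test_functions"
proof -
  obtain d e where "d > 0" "\<And>x. x $ 1 \<le> d \<or> 1 - d \<le> x $ 1 \<Longrightarrow> f x = 0"
    "e > 0" "\<And>x. x $ 1 \<le> e \<or> 1 - e \<le> x $ 1 \<Longrightarrow> g x = 0"
    using assms unfolding test_functions_def by blast
  then have "\<exists>d>0. \<forall>x. x $ 1 \<le> d \<or> 1 - d \<le> x $ 1 \<longrightarrow> f x + g x = 0"
    by (intro exI[of _ "min d e"]) (auto simp: min_def split: if_splits)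
  then show ?thesis
    using assms by (auto simp: test_functions_def smooth_periodic_def periodic_on_def C_k_add)
qed

lemma axis_nth_simps: "axis 2 (1::real) $ (1::3) = 0" "axis 3 (1::real) $ (1::3) = 0"
  "axis 2 (1::real) $ (3::3) = 0" "axis 3 (1::real) $ (2::3) = 0"
  by (auto simp: axis_def)

text \<open>
  The cell is half open in the periodic coordinates; up to a null set it is the open unit cube, in
  which signs of the bump functions below need no discussion of the end points.
\<close>

lemma AE_open_cell: "AE x in \<mu>. x \<in> box 0 1"
proof -
  have "negligible {x :: real ^ 3. x $ k = 0}" for k
    by (rule negligible_standard_hyperplane_cart)
  then have n: "negligible ({x :: real ^ 3. x $ 2 = 0} \<union> {x. x $ 3 = 0})" by simp
  have "AE x in lebesgue. x \<notin> {x :: real ^ 3. x $ 2 = 0} \<union> {x. x $ 3 = 0}"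
    by (rule AE_not_in) (use n in \<open>simp only: negligible_iff_null_sets\<close>)
  then have "AE x in lebesgue. x \<in> cell \<longrightarrow> x \<in> box 0 1"
    by eventually_elim (auto simp: cell_def mem_box_cart forall_3 less_le)
  then show ?thesis using cell_lebesgue by (simp add: AE_restrict_space_iff)
qed

text \<open>
  A smooth function of period 1 whose positivity set inside the unit interval is \<open>(a, b)\<close>, provided
  that \<open>0 \<le> a < b \<le> 1\<close>. Each sine changes sign under \<open>t \<mapsto> t + 1\<close>, so their product is periodic.
\<close>

definition periodic_bump :: "real \<Rightarrow> real \<Rightarrow> real \<Rightarrow> real" where
  "periodic_bump a b t = flat (sin (pi * (t - a)) * sin (pi * (b - t)))"

lemma periodic_bump_periodic: "periodic_bump a b (t + 1) = periodic_bump a b t"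
proof -
  have "sin (pi * (t + 1 - a)) = - sin (pi * (t - a))"
    using sin_periodic_pi[of "pi * (t - a)"] by (simp add: algebra_simps)
  moreover have "sin (pi * (b - (t + 1))) = - sin (pi * (b - t))"
    using sin_periodic_pi[of "pi * (b - (t + 1))"] by (simp add: algebra_simps)
  ultimately show ?thesis by (simp add: periodic_bump_def)
qed

lemma sin_pi_pos_iff: "\<bar>t\<bar> < 1 \<Longrightarrow> sin (pi * t) > 0 \<longleftrightarrow> t > 0"
proof -
  assume t: "\<bar>t\<bar> < 1"
  have pos: "sin (pi * s) > 0" if "0 < s" "s < 1" for s
    using that by (intro sin_gt_zero) auto
  show ?thesis
  proof (cases "t > 0")
    case False
    then have "t = 0 \<or> sin (pi * (- t)) > 0" using t pos[of "- t"] by (cases "t < 0") auto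
    then show ?thesis using False by auto
  qed (use pos[of t] t in auto)
qed

lemma periodic_bump_pos_iff:
  assumes "0 \<le> a" "a < b" "b \<le> 1" "0 < t" "t < 1"
  shows "periodic_bump a b t > 0 \<longleftrightarrow> a < t \<and> t < b"
proof -
  have 1: "sin (pi * (t - a)) > 0 \<longleftrightarrow> a < t" "sin (pi * (a - t)) > 0 \<longleftrightarrow> t < a"
    using sin_pi_pos_iff[of "t - a"] sin_pi_pos_iff[of "a - t"] assms by auto
  have 2: "sin (pi * (b - t)) > 0 \<longleftrightarrow> t < b" "sin (pi * (t - b)) > 0 \<longleftrightarrow> b < t"
    using sin_pi_pos_iff[of "b - t"] sin_pi_pos_iff[of "t - b"] assms by auto
  have "sin (pi * (a - t)) = - sin (pi * (t - a))" "sin (pi * (t - b)) = - sin (pi * (b - t))"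
    by (simp_all flip: sin_minus add: algebra_simps)
  then show ?thesis
    using 1 2 assms by (auto simp: periodic_bump_def flat_pos_iff zero_less_mult_iff)
qed

lemma periodic_bump_nonneg: "periodic_bump a b t \<ge> 0"
  by (simp add: periodic_bump_def flat_nonneg)

lemma C_k_periodic_bump: "C_k k f \<Longrightarrow> C_k k (\<lambda>x. periodic_bump a b (f x))"
  unfolding periodic_bump_def by (intro C_k_intros)

text \<open>
  For large \<open>c\<close> this is close to 1 in the interior of the unit interval, and it vanishes within
  distance \<open>1/c\<close> of the end points. Expressing it through \<open>t (1 - t)\<close> treats both ends at once and makes its
  derivative at most a multiple of \<open>1 / (t (1 - t))\<close>, the weight in Hardy's inequality.
\<close>

definition cutoff :: "real \<Rightarrow> real \<Rightarrow> real" where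
  "cutoff c t = flat (c * (t * (1 - t)) - 1)"

lemma C_k_cutoff: "C_k k f \<Longrightarrow> C_k k (\<lambda>x. cutoff c (f x))"
  unfolding cutoff_def by (intro C_k_intros)

lemma cutoff_nonneg: "cutoff c t \<ge> 0" and cutoff_le_1: "cutoff c t \<le> 1"
  by (simp_all add: cutoff_def flat_nonneg flat_le_1)

lemma cutoff_eq_0:
  assumes "c \<ge> 1" "t \<le> 1 / c \<or> 1 - 1 / c \<le> t"
  shows "cutoff c t = 0"
proof -
  have "t * (1 - t) \<le> 1 / c"
  proof (cases "0 < t \<and> t < 1")
    case True
    then have "t * (1 - t) \<le> t" "t * (1 - t) \<le> 1 - t"
      using mult_right_le_one_le[of t "1 - t"] mult_left_le_one_le[of "1 - t" t] by auto
    then show ?thesis using assms(2) by linarith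
  next
    case False
    then have "t * (1 - t) \<le> 0" by (auto simp: mult_le_0_iff)
    moreover have "0 \<le> 1 / c" using assms(1) by simp
    ultimately show ?thesis by linarith
  qed
  then have "c * (t * (1 - t)) \<le> 1" using assms(1) by (simp add: field_simps)
  then show ?thesis by (simp add: cutoff_def flat_eq)
qed

lemma cutoff_mult_test_function:
  assumes "f \<in> smooth_periodic" "c \<ge> 1"
  shows "(\<lambda>x. cutoff c (x $ 1) * f x) \<in> test_functions"
  unfolding test_functions_def smooth_periodic_def
proof (safe; (intro allI)?)
  show "C_k k (\<lambda>x. cutoff c (x $ 1) * f x)" for k
    by (intro C_k_mult C_k_cutoff C_k_coordinate smooth_periodic_C_k assms)
  show "periodic_on UNIV (\<lambda>x. cutoff c (x $ 1) * f x)"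
    using assms by (auto simp: periodic_on_def smooth_periodic_def axis_nth_simps)
  show "\<exists>d>0. \<forall>x. x $ 1 \<le> d \<or> 1 - d \<le> x $ 1 \<longrightarrow> cutoff c (x $ 1) * f x = 0"
    using assms cutoff_eq_0 by (intro exI[of _ "1 / c"]) auto
qed

lemma cutoff_tendsto:
  assumes "0 < t" "t < 1"
  shows "(\<lambda>n. cutoff (real (Suc n)) t) \<longlonglongrightarrow> 1"
proof -
  have \<tau>: "t * (1 - t) > 0" using assms by simp
  have "filterlim (\<lambda>n. real (Suc n) * (t * (1 - t))) at_top sequentially"
    by (rule filterlim_at_top_mult_tendsto_pos[OF tendsto_const \<tau>])
      (use filterlim_sequentially_Suc filterlim_real_sequentially in blast)
  then have lim: "filterlim (\<lambda>n. - 1 + real (Suc n) * (t * (1 - t))) at_top sequentially"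
    by (rule filterlim_tendsto_add_at_top[OF tendsto_const])
  have "(\<lambda>n. exp (- inverse (- 1 + real (Suc n) * (t * (1 - t))))) \<longlonglongrightarrow> exp (- 0)"
    by (intro tendsto_intros tendsto_inverse_0_at_top lim)
  then have "(\<lambda>n. exp (- inverse (- 1 + real (Suc n) * (t * (1 - t))))) \<longlonglongrightarrow> 1" by simp
  moreover have "\<forall>\<^sub>F n in sequentially. exp (- inverse (- 1 + real (Suc n) * (t * (1 - t)))) = cutoff (real (Suc n)) t"
    using lim[unfolded filterlim_at_top_dense, rule_format, of 0]
    by eventually_elim (simp add: cutoff_def flat_eq inverse_eq_divide)
  ultimately show ?thesis by (rule Lim_transform_eventually)
qed

section \<open>Density of test functions\<close>

text \<open>
  The closure of the test functions in the space of square integrable functions on the cell, which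
  will turn out to be the whole space.
\<close>

definition approximable :: "(real ^ 3 \<Rightarrow> real) \<Rightarrow> bool" where
  "approximable f \<longleftrightarrow> square_integrable \<mu> f \<and>
     (\<forall>e>0. \<exists>\<eta>\<in>test_functions. (\<integral>x. (f x - \<eta> x)\<^sup>2 \<partial>\<mu>) < e)"

lemma approximableE:
  assumes "approximable f"
  obtains F where "\<And>n. F n \<in> test_functions" "L2_tendsto \<mu> F f"
proof -
  have "\<forall>n. \<exists>\<eta>\<in>test_functions. (\<integral>x. (f x - \<eta> x)\<^sup>2 \<partial>\<mu>) < 1 / real (Suc n)"
    using assms by (auto simp: approximable_def)
  then obtain F where F: "\<And>n. F n \<in> test_functions" "\<And>n. (\<integral>x. (f x - F n x)\<^sup>2 \<partial>\<mu>) < 1 / real (Suc n)"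
    by metis
  have "(\<lambda>n. \<integral>x. (F n x - f x)\<^sup>2 \<partial>\<mu>) \<longlonglongrightarrow> 0"
    by (rule tendsto_sandwich[OF _ _ tendsto_const LIMSEQ_inverse_real_of_nat])
      (auto intro!: always_eventually integral_nonneg_AE less_imp_le[OF F(2)]
        simp: power2_commute[of "F _ _"] inverse_eq_divide simp del: of_nat_Suc)
  then show thesis
    using F(1) assms test_square_integrable by (intro that[of F]) (auto simp: L2_tendsto_def approximable_def)
qed

lemma approximable_limit:
  assumes "\<And>n. approximable (F n)" "L2_tendsto \<mu> F f"
  shows "approximable f"
  unfolding approximable_def
proof (intro conjI allI impI)
  show f: "square_integrable \<mu> f" using assms by (simp add: L2_tendsto_def)
  fix e :: real assume "e > 0"
  then have "\<forall>\<^sub>F n in sequentially. (\<integral>x. (F n x - f x)\<^sup>2 \<partial>\<mu>) < e / 4"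
    using assms(2) by (intro order_tendstoD(2)[where y = 0]) (auto simp: L2_tendsto_def)
  then obtain n where n: "(\<integral>x. (F n x - f x)\<^sup>2 \<partial>\<mu>) < e / 4"
    by (auto dest: eventually_happens)
  obtain \<eta> where \<eta>: "\<eta> \<in> test_functions" "(\<integral>x. (F n x - \<eta> x)\<^sup>2 \<partial>\<mu>) < e / 4"
    using assms(1)[of n] \<open>e > 0\<close> unfolding approximable_def by (auto dest!: spec[of _ "e / 4"])
  have sF: "square_integrable \<mu> (F n)" using assms(1) by (simp add: approximable_def)
  have i: "integrable \<mu> (\<lambda>x. (F n x - f x)\<^sup>2)" "integrable \<mu> (\<lambda>x. (F n x - \<eta> x)\<^sup>2)"
    "integrable \<mu> (\<lambda>x. (f x - \<eta> x)\<^sup>2)"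
    using square_integrable_diff[OF sF f] square_integrable_diff[OF sF test_square_integrable(1)[OF \<eta>(1)]]
      square_integrable_diff[OF f test_square_integrable(1)[OF \<eta>(1)]]
    by (auto simp: square_integrable_def)
  have "(\<integral>x. (f x - \<eta> x)\<^sup>2 \<partial>\<mu>) \<le> (\<integral>x. 2 * (F n x - f x)\<^sup>2 + 2 * (F n x - \<eta> x)\<^sup>2 \<partial>\<mu>)"
  proof (rule integral_mono)
    fix x
    show "(f x - \<eta> x)\<^sup>2 \<le> 2 * (F n x - f x)\<^sup>2 + 2 * (F n x - \<eta> x)\<^sup>2"
      using zero_le_power2[of "(F n x - f x) + (F n x - \<eta> x)"]
      by (simp add: power2_eq_square algebra_simps)
  qed (use i in auto)
  also have "\<dots> < e" using n \<eta>(2) i by simp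
  finally show "\<exists>\<eta>\<in>test_functions. (\<integral>x. (f x - \<eta> x)\<^sup>2 \<partial>\<mu>) < e" using \<eta>(1) by blast
qed

lemma approximable_test: "\<eta> \<in> test_functions \<Longrightarrow> approximable \<eta>"
  by (auto simp: approximable_def test_square_integrable intro!: bexI[of _ \<eta>])

lemma approximable_add:
  assumes "approximable f" "approximable g"
  shows "approximable (\<lambda>x. f x + g x)"
proof -
  obtain F G where F: "\<And>n. F n \<in> test_functions" "L2_tendsto \<mu> F f"
    and G: "\<And>n. G n \<in> test_functions" "L2_tendsto \<mu> G g"
    using approximableE[OF assms(1)] approximableE[OF assms(2)] by metis
  have sf: "square_integrable \<mu> f" "square_integrable \<mu> g" "square_integrable \<mu> (F n)"
    "square_integrable \<mu> (G n)" for n using F(2) G(2) by (auto simp: L2_tendsto_def)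
  have sd: "square_integrable \<mu> (\<lambda>x. F n x - f x)" "square_integrable \<mu> (\<lambda>x. G n x - g x)" 
     "square_integrable \<mu> (\<lambda>x. F n x + G n x - (f x + g x))" for n
    by (intro square_integrable_diff square_integrable_add sf)+
  have le: "(\<integral>x. (F n x + G n x - (f x + g x))\<^sup>2 \<partial>\<mu>)
      \<le> 2 * (\<integral>x. (F n x - f x)\<^sup>2 \<partial>\<mu>) + 2 * (\<integral>x. (G n x - g x)\<^sup>2 \<partial>\<mu>)" for n
  proof -
    have "(\<integral>x. (F n x + G n x - (f x + g x))\<^sup>2 \<partial>\<mu>)
        \<le> (\<integral>x. 2 * (F n x - f x)\<^sup>2 + 2 * (G n x - g x)\<^sup>2 \<partial>\<mu>)"
    proof (rule integral_mono)
      fix x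
      show "(F n x + G n x - (f x + g x))\<^sup>2 \<le> 2 * (F n x - f x)\<^sup>2 + 2 * (G n x - g x)\<^sup>2"
        using zero_le_power2[of "(F n x - f x) - (G n x - g x)"]
        by (simp add: power2_eq_square algebra_simps)
    qed (use sd[of n] in \<open>auto simp: square_integrable_def\<close>)
    then show ?thesis using sd[of n] by (simp add: square_integrable_def)
  qed
  have "(\<lambda>n. 2 * (\<integral>x. (F n x - f x)\<^sup>2 \<partial>\<mu>) + 2 * (\<integral>x. (G n x - g x)\<^sup>2 \<partial>\<mu>)) \<longlonglongrightarrow> 0"
    using F(2) G(2) by (auto simp: L2_tendsto_def intro!: tendsto_eq_intros)
  then have "(\<lambda>n. \<integral>x. (F n x + G n x - (f x + g x))\<^sup>2 \<partial>\<mu>) \<longlonglongrightarrow> 0"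
    by (rule tendsto_sandwich[OF _ _ tendsto_const, rotated 2])
      (auto intro!: always_eventually integral_nonneg_AE le)
  then have "L2_tendsto \<mu> (\<lambda>n x. F n x + G n x) (\<lambda>x. f x + g x)"
    by (auto simp: L2_tendsto_def intro!: square_integrable_add sf)
  then show ?thesis
    by (rule approximable_limit[rotated]) (intro approximable_test test_function_add F G)
qed

lemma approximable_cmult:
  assumes "approximable f"
  shows "approximable (\<lambda>x. c * f x)"
proof -
  obtain F where F: "\<And>n. F n \<in> test_functions" "L2_tendsto \<mu> F f" using approximableE[OF assms] by metis
  have "L2_tendsto \<mu> (\<lambda>n x. c * F n x) (\<lambda>x. c * f x)"
    by (rule L2_tendsto_bounded_mult[OF F(2), of _ "\<bar>c\<bar>"]) auto
  then show ?thesis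
    by (rule approximable_limit[rotated]) (intro approximable_test test_function_cmult F)
qed

lemma approximable_cong:
  assumes "approximable f" "g \<in> borel_measurable \<mu>" "AE x in \<mu>. f x = g x"
  shows "approximable g"
proof (rule approximable_limit[where F = "\<lambda>n. f"])
  have f: "square_integrable \<mu> f" using assms by (simp add: approximable_def)
  show "L2_tendsto \<mu> (\<lambda>n. f) g"
    by (rule L2_tendsto_dominated[where w = "\<lambda>x. \<bar>f x\<bar>"])
      (use f assms in \<open>auto simp: square_integrable_def elim!: eventually_mono\<close>)
qed (rule assms)

text \<open>
  If \<open>p \<ge> 0\<close> is smooth and positive exactly on the box, then \<open>1 - exp(- n p)\<close> is smooth, lies between
  0 and 1, and tends to the indicator function of the box. A factor that cuts off near the boundary
  and tends to 1 turns these functions into test functions.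
\<close>

lemma approximable_indicator_subbox:
  assumes ab: "\<And>i. 0 \<le> a $ i" "\<And>i. a $ i < b $ i" "\<And>i. b $ i \<le> 1"
  shows "approximable (indicator (box a b))"
proof -
  define p where "p x = periodic_bump (a $ 2) (b $ 2) (x $ 2) * periodic_bump (a $ 3) (b $ 3) (x $ 3)
     * flat ((x $ 1 - a $ 1) * (b $ 1 - x $ 1))" for x :: "real ^ 3"
  define F where "F n x = 1 - exp (- real n * (cutoff (real (Suc n)) (x $ 1) * p x))" for n :: nat and x
  have p0: "p x \<ge> 0" for x by (simp add: p_def periodic_bump_nonneg flat_nonneg)
  have pC: "C_k k p" for k
    unfolding p_def[abs_def] by (intro C_k_mult C_k_periodic_bump C_k_intros)
  then have p: "p \<in> smooth_periodic"
    by (auto simp: smooth_periodic_def p_def periodic_on_def axis_nth_simps periodic_bump_periodic)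
  have F: "F n \<in> test_functions" for n
  proof -
    have T: "(\<lambda>x. cutoff (real (Suc n)) (x $ 1) * p x) \<in> test_functions" (is "?q \<in> _")
      by (rule cutoff_mult_test_function[OF p]) simp
    have C: "C_k k (F n)" for k
      unfolding F_def by (intro C_k_intros C_k_cutoff smooth_periodic_C_k p)
    obtain d where "d > 0" "\<And>x. x $ 1 \<le> d \<or> 1 - d \<le> x $ 1 \<Longrightarrow> ?q x = 0"
      using T unfolding test_functions_def by blast
    then show ?thesis
      using T C unfolding test_functions_def smooth_periodic_def periodic_on_def F_def
      by (auto intro!: exI[of _ d])
  qed
  have "L2_tendsto \<mu> F (indicator (box a b))"
  proof (rule L2_tendsto_dominated[where w = "\<lambda>x. 1"])
    show "F n \<in> borel_measurable \<mu>" for n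
      using test_square_integrable(1)[OF F] by (simp add: square_integrable_def)
    show "(indicator (box a b) :: _ \<Rightarrow> real) \<in> borel_measurable \<mu>"
      by (intro borel_measurable_cell borel_measurable_indicator) auto
    show "AE x in \<mu>. \<bar>F n x\<bar> \<le> 1" for n
      using p0 by (auto simp: F_def cutoff_nonneg abs_le_iff intro!: AE_I2)
    show "AE x in \<mu>. (\<lambda>n. F n x) \<longlonglongrightarrow> indicator (box a b) x"
      using AE_open_cell
    proof eventually_elim
      case (elim x)
      then have x: "0 < x $ i" "x $ i < 1" for i by (auto simp: mem_box_cart)
      have fl: "flat ((x $ 1 - a $ 1) * (b $ 1 - x $ 1)) > 0 \<longleftrightarrow> a $ 1 < x $ 1 \<and> x $ 1 < b $ 1"
        using ab(2)[of 1] by (auto simp: flat_pos_iff zero_less_mult_iff)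
      have "p x > 0 \<longleftrightarrow> x \<in> box a b"
        using periodic_bump_pos_iff[OF ab x, of 2] periodic_bump_pos_iff[OF ab x, of 3] fl
          periodic_bump_nonneg flat_nonneg
        unfolding p_def by (auto simp: mem_box_cart forall_3 zero_less_mult_iff less_le)
      show ?case
      proof (cases "x \<in> box a b")
        case True
        then have px: "p x > 0" using \<open>p x > 0 \<longleftrightarrow> x \<in> box a b\<close> by simp
        have "(\<lambda>n. cutoff (real (Suc n)) (x $ 1) * p x) \<longlonglongrightarrow> 1 * p x"
          by (intro tendsto_intros cutoff_tendsto x)
        then have "filterlim (\<lambda>n. (cutoff (real (Suc n)) (x $ 1) * p x) * real n) at_top sequentially"
          by (rule filterlim_tendsto_pos_mult_at_top) (use px filterlim_real_sequentially in auto)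
        then have "filterlim (\<lambda>n. - ((cutoff (real (Suc n)) (x $ 1) * p x) * real n)) at_bot sequentially"
          by (simp add: filterlim_uminus_at_bot)
        then have "(\<lambda>n. 1 - exp (- ((cutoff (real (Suc n)) (x $ 1) * p x) * real n))) \<longlonglongrightarrow> 1 - 0"
          by (intro tendsto_intros filterlim_compose[OF exp_at_bot])
        then show ?thesis using True by (simp add: F_def mult.commute)
      next
        case False
        then have "p x = 0" using \<open>p x > 0 \<longleftrightarrow> x \<in> box a b\<close> p0[of x] by auto
        then show ?thesis using False by (simp add: F_def)
      qed
    qed
  qed simp
  then show ?thesis by (rule approximable_limit[rotated]) (intro approximable_test F)
qed

lemma approximable_indicator_box: "approximable (indicator (box l u))"
proof -
  define a b :: "real ^ 3" where "a = (\<chi> i. max 0 (l $ i))" and "b = (\<chi> i. min 1 (u $ i))"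
  have m: "(indicator (box l u) :: _ \<Rightarrow> real) \<in> borel_measurable \<mu>"
    by (intro borel_measurable_cell borel_measurable_indicator) auto
  have inter: "box 0 1 \<inter> box l u = box a b"
    by (auto simp: set_eq_iff mem_box_cart a_def b_def)
  show ?thesis
  proof (cases "\<forall>i. a $ i < b $ i")
    case True
    show ?thesis
    proof (rule approximable_cong[OF approximable_indicator_subbox m])
      show "AE x in \<mu>. (indicator (box a b) x :: real) = indicator (box l u) x"
        using AE_open_cell by eventually_elim (auto simp: inter[symmetric] indicator_def)
    qed (use True in \<open>auto simp: a_def b_def\<close>)
  next
    case False
    then obtain i where i: "b $ i \<le> a $ i" by (auto simp: not_less)
    have "box a b = {}"
    proof (rule equals0I)
      fix x assume "x \<in> box a b"
      then have "a $ i < x $ i" "x $ i < b $ i" by (auto simp: mem_box_cart)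
      then show False using i by linarith
    qed

    show ?thesis
    proof (rule approximable_cong[OF approximable_test[OF zero_test_function] m])
      show "AE x in \<mu>. 0 = (indicator (box l u) x :: real)"
        using AE_open_cell
      proof eventually_elim
        case (elim x)
        then show ?case using inter \<open>box a b = {}\<close> by (auto simp: indicator_def)
      qed
    qed
  qed
qed

text \<open>
  Boxes are stable under intersection and generate the Borel sets, and the sets with approximable
  indicator are closed under complements and countable disjoint unions.
\<close>

lemma approximable_indicator_borel:
  assumes "A \<in> sets borel"
  shows "approximable (indicator A)"
proof -
  have A: "A \<in> sigma_sets UNIV (range (\<lambda>(a, b). box a b))"
    using assms unfolding borel_eq_box by (simp add: sets_measure_of)
  show ?thesis
  proof (rule sigma_sets_induct_disjoint[where P = "\<lambda>A. approximable (indicator A)", OF _ _ A])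
    show "Int_stable (range (\<lambda>(a, b). box a b :: (real ^ 3) set))"
      by (rule Int_stableI, elim rangeE, clarsimp simp: box_Int_box) (rule image_eqI[of _ _ "(_, _)"], auto)
    show "approximable (indicator {})"
      by (rule approximable_cong[OF approximable_test[OF zero_test_function]]) auto
  next
    fix A :: "(real ^ 3) set" assume "A \<in> range (\<lambda>(a, b). box a b)"
    then show "approximable (indicator A)" using approximable_indicator_box by auto
  next
    fix A :: "(real ^ 3) set" assume a: "A \<in> sigma_sets UNIV (range (\<lambda>(a, b). box a b))" "approximable (indicator A)"
    then have Ab: "A \<in> sets borel" unfolding borel_eq_box by (simp add: sets_measure_of)
    show "approximable (indicator (UNIV - A))"
    proof (rule approximable_cong)
      show "approximable (\<lambda>x. indicator (box 0 1) x + - 1 * indicator A x)"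
        by (intro approximable_add approximable_cmult a approximable_indicator_box)
      show "(indicator (UNIV - A) :: _ \<Rightarrow> real) \<in> borel_measurable \<mu>"
        by (intro borel_measurable_cell borel_measurable_indicator) (use Ab in auto)
      show "AE x in \<mu>. (indicator (box 0 1) x + - 1 * indicator A x :: real) = indicator (UNIV - A) x"
        using AE_open_cell by eventually_elim (auto simp: indicator_def)
    qed
  next
    fix A :: "nat \<Rightarrow> (real ^ 3) set"
    assume a: "disjoint_family A" "range A \<subseteq> sigma_sets UNIV (range (\<lambda>(a, b). box a b))"
      "\<And>i. approximable (indicator (A i))"
    then have Ab: "A i \<in> sets borel" for i unfolding borel_eq_box by (auto simp: sets_measure_of)
    have fin: "approximable (\<lambda>x. \<Sum>i<n. indicator (A i) x)" for n
    proof (induction n)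
      case 0
      then show ?case using approximable_test[OF zero_test_function] by simp
    next
      case (Suc n)
      then show ?case using approximable_add[OF Suc a(3)[of n]] by simp
    qed
    have eq: "(\<lambda>x. \<Sum>i<n. indicator (A i) x :: real) = indicator (\<Union>i<n. A i)" for n
      by (rule ext, rule indicator_UN_disjoint[symmetric])
        (use a(1) in \<open>auto simp: disjoint_family_on_def\<close>)
    show "approximable (indicator (\<Union>i. A i))"
    proof (rule approximable_limit[OF fin], unfold eq, rule L2_tendsto_dominated[where w = "\<lambda>x. 1"])
      show "(indicator (\<Union>i<n. A i) :: _ \<Rightarrow> real) \<in> borel_measurable \<mu>" for n
        by (intro borel_measurable_cell borel_measurable_indicator) (use Ab in auto)
      show "(indicator (\<Union>i. A i) :: _ \<Rightarrow> real) \<in> borel_measurable \<mu>"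
        by (intro borel_measurable_cell borel_measurable_indicator) (use Ab in auto)
      show "AE x in \<mu>. (\<lambda>n. indicator (\<Union>i<n. A i) x :: real) \<longlonglongrightarrow> indicator (\<Union>i. A i) x"
        by (intro AE_I2 LIMSEQ_indicator_UN)
    qed (auto simp: indicator_def)
  qed auto
qed

lemma approximable_indicator:
  assumes "A \<in> sets \<mu>"
  shows "approximable (indicator A)"
proof -
  have A: "A \<in> sets lebesgue"
    using assms cell_lebesgue by (auto simp: sets_restrict_space)
  then obtain S N N' where SN: "A = S \<union> N" "N \<subseteq> N'" "N' \<in> null_sets lborel" "S \<in> sets lborel"
    by (rule sets_completionE)
  have "AE x in lebesgue. x \<notin> N'"
    by (rule AE_not_in) (use SN null_sets_completionI in auto)
  then have "AE x in lebesgue. (indicator S x :: real) = indicator A x"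
    by eventually_elim (use SN in \<open>auto simp: indicator_def\<close>)
  then have "AE x in \<mu>. (indicator S x :: real) = indicator A x"
    using cell_lebesgue by (auto simp: AE_restrict_space_iff elim: eventually_mono)
  then show ?thesis
    by (rule approximable_cong[OF approximable_indicator_borel, rotated 2])
      (use SN assms in auto)
qed

text \<open>
  Density of the test functions, obtained from indicator functions by monotone approximation of
  the positive and the negative part.
\<close>

theorem square_integrable_approximable:
  assumes "square_integrable \<mu> f"
  shows "approximable f"
proof -
  have nonneg: "approximable f" if "f \<in> borel_measurable \<mu>" "\<And>x. 0 \<le> f x" "square_integrable \<mu> f" for f
    using that
  proof (induction f rule: borel_measurable_induct_real)
    case (set A)
    then show ?case by (intro approximable_indicator)
  next
    case (mult u c)
    show ?case
    proof (cases "c = 0")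
      case True
      then show ?thesis using approximable_test[OF zero_test_function] by simp
    next
      case False
      then have "square_integrable \<mu> u" using square_integrable_cmult[OF mult.prems, of "1 / c"] by simp
      then show ?thesis using mult.IH approximable_cmult by blast
    qed
  next
    case (add u v)
    have "square_integrable \<mu> w"
      if "w \<in> borel_measurable \<mu>" "\<And>x. 0 \<le> w x" "\<And>x. w x \<le> v x + u x" for w
      unfolding square_integrable_def
    proof
      show "integrable \<mu> (\<lambda>x. (w x)\<^sup>2)"
        by (rule Bochner_Integration.integrable_bound[where f = "\<lambda>x. (v x + u x)\<^sup>2"])
          (use that add.prems in \<open>auto simp: square_integrable_def intro!: power_mono\<close>)
    qed (rule that)
    then have "square_integrable \<mu> u" "square_integrable \<mu> v" using add.hyps by auto
    then show ?case using add.IH approximable_add by blast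
  next
    case (seq U)
    have le: "U i x \<le> f x" if "x \<in> cell" for i x
      using seq.hyps(4)[of x] seq.hyps(3) that
      by (intro incseq_le[of "\<lambda>i. U i x"]) (auto simp: incseq_def le_fun_def)
    have "square_integrable \<mu> (U i)" for i
      unfolding square_integrable_def
    proof
      show "integrable \<mu> (\<lambda>x. (U i x)\<^sup>2)"
        by (rule Bochner_Integration.integrable_bound[where f = "\<lambda>x. (f x)\<^sup>2"])
          (use seq le in \<open>auto simp: square_integrable_def intro!: AE_I2 power_mono\<close>)
    qed (rule seq)
    then have "approximable (U i)" for i using seq.IH by blast
    moreover have "L2_tendsto \<mu> U f"
      by (rule L2_tendsto_dominated[where w = f])
        (use seq le in \<open>auto simp: square_integrable_def intro!: AE_I2\<close>)
    ultimately show ?case by (rule approximable_limit)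
  qed
  have m: "f \<in> borel_measurable \<mu>" using assms by (simp add: square_integrable_def)
  have sq: "square_integrable \<mu> (\<lambda>x. max 0 (c * f x))" if "\<bar>c\<bar> = 1" for c
    unfolding square_integrable_def
  proof
    show "integrable \<mu> (\<lambda>x. (max 0 (c * f x))\<^sup>2)"
      by (rule Bochner_Integration.integrable_bound[where f = "\<lambda>x. (f x)\<^sup>2"])
        (use assms m that in \<open>auto simp: square_integrable_def max_def power_mult_distrib abs_square_eq_1[symmetric]\<close>)
  qed (use m in auto)
  have "approximable (\<lambda>x. max 0 (1 * f x) + - 1 * max 0 (- 1 * f x))"
    by (intro approximable_add approximable_cmult nonneg sq) (use m in auto)
  moreover have "(\<lambda>x. max 0 (1 * f x) + - 1 * max 0 (- 1 * f x)) = f" by (auto simp: max_def)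
  ultimately show ?thesis by simp
qed

lemma obtain_test_sequence:
  assumes "square_integrable \<mu> f"
  obtains F where "\<And>n. F n \<in> test_functions" "L2_tendsto \<mu> F f"
  using approximableE[OF square_integrable_approximable[OF assms]] by blast

text \<open>
  Approximating \<open>f\<close> itself by test functions shows that \<open>f\<close> is orthogonal to \<open>f\<close>. Consequently
  weak partial derivatives are unique up to null sets.
\<close>

lemma AE_zero_if_orthogonal_to_test_functions:
  assumes "square_integrable \<mu> f" "\<And>\<eta>. \<eta> \<in> test_functions \<Longrightarrow> (\<integral>x. \<eta> x * f x \<partial>\<mu>) = 0"
  shows "AE x in \<mu>. f x = 0"
proof -
  obtain F where F: "\<And>n. F n \<in> test_functions" "L2_tendsto \<mu> F f" using obtain_test_sequence[OF assms(1)] by blast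
  have "(\<lambda>n. \<integral>x. F n x * f x \<partial>\<mu>) \<longlonglongrightarrow> (\<integral>x. f x * f x \<partial>\<mu>)"
    by (rule L2_tendsto_pairing[OF F(2) assms(1)])
  then have "(\<integral>x. f x * f x \<partial>\<mu>) = 0" using assms(2)[OF F(1)] by (simp add: LIMSEQ_const_iff)
  then have "AE x in \<mu>. f x * f x = 0"
    by (subst (asm) integral_nonneg_eq_0_iff_AE) (auto intro: square_integrable_mult assms)
  then show ?thesis by simp
qed

section \<open>Translation in the periodic directions\<close>

lemma cell_subset_strip: "x \<in> cell \<Longrightarrow> x \<in> strip"
  by (simp add: cell_def strip_def)

lemma strip_shift: "j \<noteq> 1 \<Longrightarrow> x + axis j s \<in> strip \<longleftrightarrow> x \<in> strip"
  by (auto simp: strip_def axis_def)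

lemma cell_shift_iff:
  assumes "j \<noteq> 1" "x \<in> cell"
  shows "x + axis j r \<in> cell \<longleftrightarrow> 0 \<le> x $ j + r \<and> x $ j + r < 1"
  using assms exhaust_3[of j] by (auto simp: cell_def axis_def)

lemma axis_add: "axis j a + axis j b = axis j (a + b :: real)"
  by (auto simp: axis_def vec_eq_iff)

lemma axis_0: "axis j (0 :: real) = 0"
  by (auto simp: axis_def vec_eq_iff)

lemma periodic_shift_nat:
  assumes "periodic_on strip f" "j \<noteq> 1" "x \<in> strip"
  shows "f (x + axis j (real n)) = f x"
proof (induction n)
  case (Suc n)
  have "x + axis j (real n) \<in> strip" using assms by (simp add: strip_shift)
  then have "f (x + axis j (real n) + axis j 1) = f (x + axis j (real n))"
    using assms(1,2) exhaust_3[of j] by (auto simp: periodic_on_def)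
  moreover have "x + axis j (real n) + axis j 1 = x + axis j (real (Suc n))"
    by (simp add: add.assoc axis_add add.commute)
  ultimately show ?case using Suc by simp
qed (simp add: axis_0)

lemma periodic_shift_int:
  assumes "periodic_on strip f" "j \<noteq> 1" "x \<in> strip"
  shows "f (x + axis j (of_int k)) = f x"
proof (cases "k \<ge> 0")
  case True
  then show ?thesis using periodic_shift_nat[OF assms, of "nat k"] by simp
next
  case False
  have "f (x + axis j (of_int k) + axis j (real (nat (- k)))) = f (x + axis j (of_int k))"
    by (rule periodic_shift_nat) (use assms in \<open>simp_all add: strip_shift\<close>)
  then show ?thesis using False by (simp add: add.assoc axis_add axis_0)
qed

text \<open>
  For \<open>0 \<le> s < 1\<close>, translation by \<open>s\<close> in direction \<open>j\<close> on the torus, expressed on the fundamental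
  cell: the part that leaves the cell reenters on the opposite side.
\<close>

definition wrap :: "3 \<Rightarrow> real \<Rightarrow> real ^ 3 \<Rightarrow> real ^ 3" where
  "wrap j s x = (if x $ j + s < 1 then x + axis j s else x + axis j (s - 1))"

lemma wrap_vimage:
  assumes "j \<noteq> 1" "0 \<le> s" "s < 1" "A \<subseteq> cell"
  shows "wrap j s -` A \<inter> cell
    = (+) (axis j (- s)) ` (A \<inter> {y. s \<le> y $ j}) \<union> (+) (axis j (1 - s)) ` (A \<inter> {y. y $ j < s})"
    (is "?L = ?B \<union> ?C")
proof (intro equalityI subsetI)
  fix x assume x: "x \<in> ?L"
  then have c: "x \<in> cell" "0 \<le> x $ j" using exhaust_3[of j] by (auto simp: cell_def)
  show "x \<in> ?B \<union> ?C"
  proof (cases "x $ j + s < 1")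
    case True
    then have "x = axis j (- s) + (x + axis j s)" "x + axis j s \<in> A \<inter> {y. s \<le> y $ j}"
      using x c by (auto simp: wrap_def axis_add[symmetric] axis_def vec_eq_iff)
    then show ?thesis by blast
  next
    case False
    have "x $ j < 1" using c(1) exhaust_3[of j] by (auto simp: cell_def)
    then have "x = axis j (1 - s) + (x + axis j (s - 1))" "x + axis j (s - 1) \<in> A \<inter> {y. y $ j < s}"
      using x False by (auto simp: wrap_def axis_def vec_eq_iff)
    then show ?thesis by blast
  qed
next
  fix x assume "x \<in> ?B \<union> ?C"
  then show "x \<in> ?L"
  proof
    assume "x \<in> ?B"
    then obtain y where y: "y \<in> A" "s \<le> y $ j" and x: "x = y + axis j (- s)" by (auto simp: add.commute)
    have "y \<in> cell" "y $ j < 1" using y assms(4) exhaust_3[of j] by (auto simp: cell_def)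
    then have "x \<in> cell" using y assms by (simp add: x cell_shift_iff)
    then show ?thesis using y \<open>y $ j < 1\<close> by (simp add: wrap_def x add.assoc axis_add axis_0)
  next
    assume "x \<in> ?C"
    then obtain y where y: "y \<in> A" "y $ j < s" and x: "x = y + axis j (1 - s)" by (auto simp: add.commute)
    have "y \<in> cell" "0 \<le> y $ j" using y assms(4) exhaust_3[of j] by (auto simp: cell_def)
    then have "x \<in> cell" using y assms by (simp add: x cell_shift_iff)
    then show ?thesis using y \<open>0 \<le> y $ j\<close> by (simp add: wrap_def x add.assoc axis_add axis_0)
  qed
qed

lemma cell_sets_iff: "A \<in> sets \<mu> \<longleftrightarrow> A \<in> sets lebesgue \<and> A \<subseteq> cell"
  using cell_lebesgue by (auto simp: sets_restrict_space_iff)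

lemma half_space_lebesgue: "{y :: real ^ 3. s \<le> y $ j} \<in> sets lebesgue" "{y :: real ^ 3. y $ j < s} \<in> sets lebesgue"
proof -
  have "{y :: real ^ 3. s \<le> y $ j} \<in> sets borel" "{y :: real ^ 3. y $ j < s} \<in> sets borel"
    by measurable
  then show "{y :: real ^ 3. s \<le> y $ j} \<in> sets lebesgue" "{y :: real ^ 3. y $ j < s} \<in> sets lebesgue"
    by (simp_all add: sets_completionI_sets)
qed

lemma wrap_measurable:
  assumes "j \<noteq> 1" "0 \<le> s" "s < 1"
  shows "wrap j s \<in> measurable \<mu> \<mu>"
proof (rule measurableI)
  fix x assume "x \<in> space \<mu>"
  then have x: "x \<in> cell" "0 \<le> x $ j" "x $ j < 1" using exhaust_3[of j] by (auto simp: cell_def)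
  then show "wrap j s x \<in> space \<mu>" using assms by (auto simp: wrap_def cell_shift_iff)
next
  fix A assume "A \<in> sets \<mu>"
  then have A: "A \<in> sets lebesgue" "A \<subseteq> cell" by (auto simp: cell_sets_iff)
  have "wrap j s -` A \<inter> cell \<in> sets lebesgue"
    unfolding wrap_vimage[OF assms A(2)]
    by (intro sets.Un lebesgue_sets_translation sets.Int A half_space_lebesgue)
  then show "wrap j s -` A \<inter> space \<mu> \<in> sets \<mu>" by (simp add: cell_sets_iff)
qed

text \<open>
  Translation on the torus preserves the measure: the two pieces into which it cuts the cell are
  moved by ordinary translations to disjoint places.
\<close>

lemma distr_wrap:
  assumes "j \<noteq> 1" "0 \<le> s" "s < 1"
  shows "distr \<mu> \<mu> (wrap j s) = \<mu>"
proof (rule measure_eqI)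
  fix A assume "A \<in> sets (distr \<mu> \<mu> (wrap j s))"
  then have A': "A \<in> sets \<mu>" by simp
  then have A: "A \<in> sets lebesgue" "A \<subseteq> cell" by (auto simp: cell_sets_iff)
  let ?P = "A \<inter> {y. s \<le> y $ j}" and ?Q = "A \<inter> {y. y $ j < s}"
  let ?B = "(+) (axis j (- s)) ` ?P" and ?C = "(+) (axis j (1 - s)) ` ?Q"
  have pre: "wrap j s -` A \<inter> cell = ?B \<union> ?C" by (rule wrap_vimage[OF assms A(2)])
  have l: "?P \<in> lmeasurable" "?Q \<in> lmeasurable" "?B \<in> lmeasurable" "?C \<in> lmeasurable"
    using A half_space_lebesgue
    by (auto intro!: measurable_translation fmeasurableI2[OF cell_lmeasurable] sets.Int)
  have "x $ j < 1 - s" if "x \<in> ?B" for x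
    using that A(2) exhaust_3[of j] by (auto simp: cell_def)
  moreover have "x $ j \<ge> 1 - s" if "x \<in> ?C" for x
    using that A(2) exhaust_3[of j] by (auto simp: cell_def)
  ultimately have disj: "?B \<inter> ?C = {}" by force
  have "measure \<mu> (wrap j s -` A \<inter> cell) = measure lebesgue (?B \<union> ?C)"
    using cell_lebesgue pre by (metis Int_lower2 measure_restrict_space sets.Int_space_eq2 space_completion space_lborel UNIV_I Int_UNIV_right)
  also have "\<dots> = measure lebesgue ?B + measure lebesgue ?C"
    by (rule measure_Union) (use l disj in \<open>auto simp: fmeasurable_def\<close>)
  also have "\<dots> = measure lebesgue ?P + measure lebesgue ?Q" by (simp only: measure_translation)
  also have "\<dots> = measure lebesgue (?P \<union> ?Q)"
    by (rule measure_Union[symmetric]) (use l in \<open>auto simp: fmeasurable_def\<close>)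
  also have "?P \<union> ?Q = A" by auto
  also have "measure lebesgue A = measure \<mu> A" using A cell_lebesgue by (simp add: measure_restrict_space)
  finally show "emeasure (distr \<mu> \<mu> (wrap j s)) A = emeasure \<mu> A"
    using A' by (simp add: emeasure_distr wrap_measurable assms cell.emeasure_eq_measure)
qed simp

lemma periodic_shift_frac:
  assumes "periodic_on strip f" "j \<noteq> 1" "x \<in> cell"
  shows "f (x + axis j s) = f (wrap j (frac s) x)"
proof -
  have x: "x \<in> strip" using assms by (simp add: cell_subset_strip)
  have "f (x + axis j (frac s) + axis j (of_int \<lfloor>s\<rfloor>)) = f (x + axis j (frac s))"
    by (rule periodic_shift_int) (use assms x in \<open>simp_all add: strip_shift\<close>)
  then have 1: "f (x + axis j s) = f (x + axis j (frac s))" by (simp add: add.assoc axis_add frac_def)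
  have "f (x + axis j (frac s - 1) + axis j (of_int 1)) = f (x + axis j (frac s - 1))"
    by (rule periodic_shift_int) (use assms x in \<open>simp_all add: strip_shift\<close>)
  then have "f (x + axis j (frac s)) = f (x + axis j (frac s - 1))" by (simp add: add.assoc axis_add)
  then show ?thesis using 1 by (simp add: wrap_def)
qed

lemma shift_measurable:
  assumes "periodic_on strip f" "j \<noteq> 1" "f \<in> borel_measurable \<mu>"
  shows "(\<lambda>x. f (x + axis j s)) \<in> borel_measurable \<mu>"
proof -
  have "(\<lambda>x. f (wrap j (frac s) x)) \<in> borel_measurable \<mu>"
    using measurable_compose[OF wrap_measurable assms(3)] assms(2) by (simp add: frac_lt_1)
  moreover have "f (x + axis j s) = f (wrap j (frac s) x)" if "x \<in> space \<mu>" for x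
    using periodic_shift_frac[OF assms(1,2)] that by simp
  ultimately show ?thesis by (subst measurable_cong) 
qed

lemma shift_integral:
  fixes f :: "real ^ 3 \<Rightarrow> real"
  assumes "periodic_on strip f" "j \<noteq> 1" "f \<in> borel_measurable \<mu>"
  shows "(\<integral>x. f (x + axis j s) \<partial>\<mu>) = (\<integral>x. f x \<partial>\<mu>)"
    and "integrable \<mu> (\<lambda>x. f (x + axis j s)) \<longleftrightarrow> integrable \<mu> f"
proof -
  have w: "wrap j (frac s) \<in> measurable \<mu> \<mu>" and d: "distr \<mu> \<mu> (wrap j (frac s)) = \<mu>"
    by (intro wrap_measurable distr_wrap; simp add: assms frac_lt_1)+
  have "(\<integral>x. f (x + axis j s) \<partial>\<mu>) = (\<integral>x. f (wrap j (frac s) x) \<partial>\<mu>)"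
    by (rule Bochner_Integration.integral_cong[OF refl]) (simp add: periodic_shift_frac[OF assms(1,2)])
  also have "\<dots> = (\<integral>x. f x \<partial>distr \<mu> \<mu> (wrap j (frac s)))"
    by (rule integral_distr[symmetric, OF w assms(3)])
  finally show "(\<integral>x. f (x + axis j s) \<partial>\<mu>) = (\<integral>x. f x \<partial>\<mu>)" by (simp add: d)
  have "integrable \<mu> (\<lambda>x. f (x + axis j s)) \<longleftrightarrow> integrable \<mu> (\<lambda>x. f (wrap j (frac s) x))"
    by (rule Bochner_Integration.integrable_cong[OF refl]) (simp add: periodic_shift_frac[OF assms(1,2)])
  also have "\<dots> \<longleftrightarrow> integrable (distr \<mu> \<mu> (wrap j (frac s))) f"
    by (rule integrable_distr_eq[symmetric, OF w assms(3)])
  finally show "integrable \<mu> (\<lambda>x. f (x + axis j s)) \<longleftrightarrow> integrable \<mu> f" by (simp add: d)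
qed

lemma L2_real_iff: "f \<in> L2 \<longleftrightarrow> periodic_on strip f \<and> square_integrable \<mu> f" for f :: "real ^ 3 \<Rightarrow> real"
  by (simp add: L2_def square_integrable_def)

lemma periodic_on_subset: "periodic_on S f \<Longrightarrow> T \<subseteq> S \<Longrightarrow> periodic_on T f"
  by (auto simp: periodic_on_def)

lemma L2_shift:
  fixes f :: "real ^ 3 \<Rightarrow> real"
  assumes "f \<in> L2" "j \<noteq> 1"
  shows "(\<lambda>x. f (x + axis j s)) \<in> L2" "(\<integral>x. (f (x + axis j s))\<^sup>2 \<partial>\<mu>) = (\<integral>x. (f x)\<^sup>2 \<partial>\<mu>)"
proof -
  have f: "periodic_on strip f" "f \<in> borel_measurable \<mu>" "integrable \<mu> (\<lambda>x. (f x)\<^sup>2)"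
    using assms by (auto simp: L2_def)
  have f2: "periodic_on strip (\<lambda>x. (f x)\<^sup>2)" "(\<lambda>x. (f x)\<^sup>2) \<in> borel_measurable \<mu>"
    using f by (auto simp: periodic_on_def)
  show "(\<integral>x. (f (x + axis j s))\<^sup>2 \<partial>\<mu>) = (\<integral>x. (f x)\<^sup>2 \<partial>\<mu>)"
    by (rule shift_integral(1)[OF f2(1) assms(2) f2(2)])
  have "integrable \<mu> (\<lambda>x. (f (x + axis j s))\<^sup>2)"
    using shift_integral(2)[OF f2(1) assms(2) f2(2)] f(3) by blast
  moreover have "periodic_on strip (\<lambda>x. f (x + axis j s))"
    unfolding periodic_on_def
  proof
    fix x assume "x \<in> strip"
    then have "x + axis j s \<in> strip" using assms by (simp add: strip_shift)
    then have "f (x + axis j s + axis 2 1) = f (x + axis j s) \<and> f (x + axis j s + axis 3 1) = f (x + axis j s)"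
      using f(1) by (simp add: periodic_on_def)
    then show "f (x + axis 2 1 + axis j s) = f (x + axis j s) \<and> f (x + axis 3 1 + axis j s) = f (x + axis j s)"
      by (simp add: add.assoc add.commute[of "axis j s"])
  qed
  ultimately show "(\<lambda>x. f (x + axis j s)) \<in> L2"
    using shift_measurable[OF f(1) assms(2) f(2)] by (simp add: L2_def)
qed

lemma L2_square_integrable: "f \<in> L2 \<Longrightarrow> square_integrable \<mu> f" for f :: "real ^ 3 \<Rightarrow> real"
  by (simp add: L2_real_iff)

lemma shift_pairing:
  fixes f g :: "real ^ 3 \<Rightarrow> real"
  assumes "f \<in> L2" "g \<in> L2" "j \<noteq> 1"
  shows "(\<integral>x. f x * g (x + axis j s) \<partial>\<mu>) = (\<integral>x. f (x + axis j (- s)) * g x \<partial>\<mu>)"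
proof -
  let ?h = "\<lambda>x. f (x + axis j (- s)) * g x"
  have p: "periodic_on strip f" "periodic_on strip g" "(\<lambda>x. f (x + axis j (- s))) \<in> L2"
    using assms L2_shift by (auto simp: L2_real_iff)
  then have "periodic_on strip ?h" by (auto simp: L2_real_iff periodic_on_def)
  moreover have "?h \<in> borel_measurable \<mu>"
    using p(3) assms by (auto simp: L2_real_iff square_integrable_def)
  ultimately have "(\<integral>x. ?h (x + axis j s) \<partial>\<mu>) = (\<integral>x. ?h x \<partial>\<mu>)"
    using shift_integral(1)[OF _ assms(3)] by blast
  then show ?thesis by (simp add: add.assoc axis_add axis_0)
qed

lemma smooth_periodic_L2: "f \<in> smooth_periodic \<Longrightarrow> f \<in> L2"
  by (simp add: L2_real_iff smooth_square_integrable(1)[OF smooth_periodic_C_k]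
      periodic_on_subset[OF _ subset_UNIV, of f] smooth_periodic_def)

lemma smooth_periodic_partial_L2:
  assumes "f \<in> smooth_periodic"
  shows "classical_partial j f \<in> L2"
proof -
  have d: "f differentiable (at x)" for x using smooth_periodic_C_k[OF assms, of 1] by simp
  have "(\<lambda>x. f (x + axis 2 1)) = f" "(\<lambda>x. f (x + axis 3 1)) = f"
    using assms by (auto simp: smooth_periodic_def periodic_on_def)
  then have "classical_partial j f (x + axis 2 1) = classical_partial j f x"
    "classical_partial j f (x + axis 3 1) = classical_partial j f x" for x
    using classical_partial_shift[OF d, of j "axis 2 1"] classical_partial_shift[OF d, of j "axis 3 1"]
    by (metis, metis)
  then show ?thesis
    using smooth_square_integrable(2)[OF smooth_periodic_C_k[OF assms]]
    by (auto simp: L2_real_iff periodic_on_def)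
qed

lemma test_function_shift:
  assumes "f \<in> test_functions" "j \<noteq> 1"
  shows "(\<lambda>x. f (x + axis j s)) \<in> test_functions"
proof -
  have "periodic_on UNIV (\<lambda>x. f (x + axis j s))"
    using assms by (auto simp: periodic_on_def test_functions_def smooth_periodic_def add.assoc
        add.commute[of "axis _ 1" "axis j s"]) (simp_all flip: add.assoc)
  then show ?thesis
    using assms by (auto simp: test_functions_def smooth_periodic_def C_k_shift axis_def)
qed

lemma is_weak_partial_shift:
  assumes "is_weak_partial i f g" "f \<in> L2" "g \<in> L2" "j \<noteq> 1"
  shows "is_weak_partial i (\<lambda>x. f (x + axis j s)) (\<lambda>x. g (x + axis j s))"
  unfolding is_weak_partial_def
proof
  fix \<phi> assume \<phi>: "\<phi> \<in> test_functions"
  have d: "\<phi> differentiable (at x)" for x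
    using smooth_periodic_C_k[OF test_function_smooth[OF \<phi>], of 1] by simp
  have "(\<integral>x. f (x + axis j s) * classical_partial i \<phi> x \<partial>\<mu>)
      = (\<integral>x. f x * classical_partial i \<phi> (x + axis j (- s)) \<partial>\<mu>)"
    using shift_pairing[OF assms(2) smooth_periodic_partial_L2[OF test_function_smooth[OF \<phi>]] assms(4), of i "- s"]
    by simp
  also have "\<dots> = - (\<integral>x. g x * \<phi> (x + axis j (- s)) \<partial>\<mu>)"
    using bspec[OF assms(1)[unfolded is_weak_partial_def] test_function_shift[OF \<phi> assms(4), of "- s"]]
    by (simp only: classical_partial_shift[OF d])
  also have "\<dots> = - (\<integral>x. g (x + axis j s) * \<phi> x \<partial>\<mu>)"
    using shift_pairing[OF assms(3) smooth_periodic_L2[OF test_function_smooth[OF \<phi>]] assms(4), of "- s"] by simp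
  finally show "(\<integral>x. f (x + axis j s) * classical_partial i \<phi> x \<partial>\<mu>) = - (\<integral>x. g (x + axis j s) * \<phi> x \<partial>\<mu>)" .
qed

lemma weak_partial_unique:
  assumes "is_weak_partial i f g" "is_weak_partial i f h" "square_integrable \<mu> g" "square_integrable \<mu> h"
  shows "AE x in \<mu>. g x = h x"
proof -
  have "AE x in \<mu>. g x - h x = 0"
  proof (rule AE_zero_if_orthogonal_to_test_functions)
    show "square_integrable \<mu> (\<lambda>x. g x - h x)" by (intro square_integrable_diff assms)
    fix \<eta> assume \<eta>: "\<eta> \<in> test_functions"
    have "(\<integral>x. g x * \<eta> x \<partial>\<mu>) = (\<integral>x. h x * \<eta> x \<partial>\<mu>)"
      using assms(1,2) \<eta> by (force simp: is_weak_partial_def)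
    then show "(\<integral>x. \<eta> x * (g x - h x) \<partial>\<mu>) = 0"
      using square_integrable_mult[OF assms(3) test_square_integrable(1)[OF \<eta>]]
        square_integrable_mult[OF assms(4) test_square_integrable(1)[OF \<eta>]]
      by (simp add: right_diff_distrib mult.commute[of "\<eta> _"])
  qed
  then show ?thesis by simp
qed

section \<open>Tangential directions: differentiating pairings along translations\<close>

lemma axis_eq_scaleR: "axis j s = s *\<^sub>R axis j (1 :: real)"
  by (simp add: axis_def vec_eq_iff)

lemma wrap_in_cell:
  assumes "j \<noteq> 1" "x \<in> cell"
  shows "wrap j (frac s) x \<in> cell"
  using measurable_space[OF wrap_measurable[OF assms(1), of "frac s"], of x] assms(2)
  by (simp add: frac_lt_1)

text \<open>
  By periodicity the values along tangential lines through the cell are values in the cell, where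
  a continuous function is bounded. The bound dominates all difference quotients.
\<close>

lemma smooth_partial_bounded_along_lines:
  assumes "\<eta> \<in> smooth_periodic" "j \<noteq> 1"
  obtains C where "\<And>x s. x \<in> cell \<Longrightarrow> \<bar>classical_partial i \<eta> (x + axis j s)\<bar> \<le> C"
proof -
  have "continuous_on (cbox 0 1) (classical_partial i \<eta>)"
    using continuous_on_subset[OF continuous_partial subset_UNIV] smooth_periodic_C_k[OF assms(1)] by blast
  then obtain C where C: "\<And>x. x \<in> cell \<Longrightarrow> \<bar>classical_partial i \<eta> x\<bar> \<le> C"
    using continuous_cell_bounded by blast
  have "periodic_on strip (classical_partial i \<eta>)"
    using smooth_periodic_partial_L2[OF assms(1)] by (simp add: L2_real_iff)
  then show thesis
    using C wrap_in_cell[OF assms(2)] by (intro that[of C]) (simp add: periodic_shift_frac assms(2))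
qed

text \<open>
  Differentiation under the integral sign; dominated convergence applies because the mean value
  theorem bounds the difference quotients of \<open>\<eta>\<close> uniformly.
\<close>

lemma smooth_shift_pairing_deriv_0:
  assumes \<eta>: "\<eta> \<in> smooth_periodic" and j: "j \<noteq> 1" and w: "square_integrable \<mu> w"
  shows "((\<lambda>s. \<integral>x. \<eta> (x + axis j s) * w x \<partial>\<mu>) has_real_derivative
    (\<integral>x. classical_partial j \<eta> x * w x \<partial>\<mu>)) (at 0)"
proof -
  obtain C where C: "\<And>x s. x \<in> cell \<Longrightarrow> \<bar>classical_partial j \<eta> (x + axis j s)\<bar> \<le> C"
    using smooth_partial_bounded_along_lines[OF \<eta> j] by metis
  have der: "((\<lambda>s. \<eta> (x + axis j s)) has_real_derivative classical_partial j \<eta> (x + axis j s)) (at s)" for x s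
    using line_derivative[of \<eta> x s j] smooth_periodic_C_k[OF \<eta>, of 1] by (simp flip: axis_eq_scaleR)
  have quot: "\<bar>(\<eta> (x + axis j h) - \<eta> x) / h\<bar> \<le> C" if "x \<in> cell" "h \<noteq> 0" for x h
  proof -
    have "norm (\<eta> (x + axis j h) - \<eta> (x + axis j 0)) \<le> C * norm (h - 0)"
      by (rule field_differentiable_bound[of UNIV "\<lambda>s. \<eta> (x + axis j s)" "\<lambda>s. classical_partial j \<eta> (x + axis j s)"])
        (use C that der in auto)
    then show ?thesis using that by (simp add: axis_0 divide_le_eq)
  qed
  have sq: "square_integrable \<mu> (\<lambda>x. \<eta> (x + axis j s))" for s
    by (intro L2_square_integrable L2_shift smooth_periodic_L2 \<eta> j)
  have i: "integrable \<mu> (\<lambda>x. \<eta> (x + axis j s) * w x)" for s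
    by (rule square_integrable_mult[OF sq w])
  have mw: "w \<in> borel_measurable \<mu>" using w by (simp add: square_integrable_def)
  show ?thesis
    unfolding DERIV_def tendsto_at_iff_sequentially comp_def
  proof (intro allI impI)
    fix X :: "nat \<Rightarrow> real" assume X: "\<forall>i. X i \<in> UNIV - {0}" "X \<longlonglongrightarrow> 0"
    have eq: "((\<integral>x. \<eta> (x + axis j (0 + X n)) * w x \<partial>\<mu>) - (\<integral>x. \<eta> (x + axis j 0) * w x \<partial>\<mu>)) / X n
        = (\<integral>x. (\<eta> (x + axis j (X n)) - \<eta> x) / X n * w x \<partial>\<mu>)" for n
    proof -
      have "(\<integral>x. \<eta> (x + axis j (0 + X n)) * w x \<partial>\<mu>) - (\<integral>x. \<eta> (x + axis j 0) * w x \<partial>\<mu>)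
          = (\<integral>x. \<eta> (x + axis j (X n)) * w x - \<eta> x * w x \<partial>\<mu>)"
        using i[of "X n"] i[of 0] by (simp add: axis_0)
      also have "\<dots> / X n = (\<integral>x. (\<eta> (x + axis j (X n)) * w x - \<eta> x * w x) / X n \<partial>\<mu>)" by simp
      finally show ?thesis by (simp add: diff_divide_distrib left_diff_distrib)
    qed
    show "(\<lambda>n. ((\<integral>x. \<eta> (x + axis j (0 + X n)) * w x \<partial>\<mu>) - (\<integral>x. \<eta> (x + axis j 0) * w x \<partial>\<mu>)) / X n)
        \<longlonglongrightarrow> (\<integral>x. classical_partial j \<eta> x * w x \<partial>\<mu>)"
      unfolding eq
    proof (rule integral_dominated_convergence[where w = "\<lambda>x. C * \<bar>w x\<bar>"])
      show "(\<lambda>x. classical_partial j \<eta> x * w x) \<in> borel_measurable \<mu>"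
        using L2_square_integrable[OF smooth_periodic_partial_L2[OF \<eta>], of j] mw
        by (auto simp: square_integrable_def)
      show "(\<lambda>x. (\<eta> (x + axis j (X n)) - \<eta> x) / X n * w x) \<in> borel_measurable \<mu>" for n
        using sq[of "X n"] sq[of 0] mw by (auto simp: square_integrable_def axis_0)
      show "integrable \<mu> (\<lambda>x. C * \<bar>w x\<bar>)" using square_integrable_cell_integrable[OF w] by simp
      show "AE x in \<mu>. (\<lambda>n. (\<eta> (x + axis j (X n)) - \<eta> x) / X n * w x) \<longlonglongrightarrow> classical_partial j \<eta> x * w x"
      proof (rule AE_I2)
        fix x
        have "((\<lambda>h. (\<eta> (x + axis j h) - \<eta> x) / h) \<longlongrightarrow> classical_partial j \<eta> x) (at 0)"
          using der[of x 0] by (simp add: DERIV_def axis_0)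
        then have "(\<lambda>n. (\<eta> (x + axis j (X n)) - \<eta> x) / X n) \<longlonglongrightarrow> classical_partial j \<eta> x"
          using X by (auto simp: tendsto_at_iff_sequentially comp_def)
        then show "(\<lambda>n. (\<eta> (x + axis j (X n)) - \<eta> x) / X n * w x) \<longlonglongrightarrow> classical_partial j \<eta> x * w x"
          by (intro tendsto_intros)
      qed
      show "AE x in \<mu>. norm ((\<eta> (x + axis j (X n)) - \<eta> x) / X n * w x) \<le> C * \<bar>w x\<bar>" for n
      proof (rule AE_I2)
        fix x assume "x \<in> space \<mu>"
        then have "\<bar>(\<eta> (x + axis j (X n)) - \<eta> x) / X n\<bar> \<le> C" using quot X(1) by auto
        then show "norm ((\<eta> (x + axis j (X n)) - \<eta> x) / X n * w x) \<le> C * \<bar>w x\<bar>"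
          unfolding real_norm_def abs_mult[of _ "w x"] by (rule mult_right_mono) simp
      qed
    qed
  qed
qed

text \<open>
  The translation is moved to the smooth factor \<open>\<eta>\<close>, where the pairing can be differentiated
  classically; the translate of \<open>\<eta>\<close> is again a test function, so the definition of the weak partial
  derivative moves the derivative back to \<open>v\<close>.
\<close>

lemma test_pairing_deriv:
  assumes \<eta>: "\<eta> \<in> test_functions" and v: "v \<in> L2" "h \<in> L2" "is_weak_partial j v h" and j: "j \<noteq> 1"
  shows "((\<lambda>s. \<integral>x. \<eta> x * v (x + axis j s) \<partial>\<mu>) has_real_derivative
    (\<integral>x. \<eta> x * h (x + axis j s) \<partial>\<mu>)) (at s)"
proof -
  have \<eta>L: "\<eta> \<in> L2" by (intro smooth_periodic_L2 test_function_smooth \<eta>)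
  have \<eta>s: "(\<lambda>x. \<eta> (x + axis j (- s))) \<in> test_functions" (is "?\<eta> \<in> _") by (rule test_function_shift[OF \<eta> j])
  have "((\<lambda>r. \<integral>x. ?\<eta> (x + axis j r) * v x \<partial>\<mu>) has_real_derivative
      (\<integral>x. classical_partial j ?\<eta> x * v x \<partial>\<mu>)) (at 0)"
    by (intro smooth_shift_pairing_deriv_0 test_function_smooth \<eta>s j L2_square_integrable v)
  also have "(\<integral>x. classical_partial j ?\<eta> x * v x \<partial>\<mu>) = - (\<integral>x. h x * ?\<eta> x \<partial>\<mu>)"
    using bspec[OF v(3)[unfolded is_weak_partial_def] \<eta>s] by (simp add: mult.commute)
  also have "(\<integral>x. h x * ?\<eta> x \<partial>\<mu>) = (\<integral>x. \<eta> x * h (x + axis j s) \<partial>\<mu>)"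
    using shift_pairing[OF \<eta>L v(2) j, of s] by (simp add: mult.commute)
  finally have "((\<lambda>r. \<integral>x. \<eta> (x + axis j (r - s)) * v x \<partial>\<mu>) has_real_derivative
      - (\<integral>x. \<eta> x * h (x + axis j s) \<partial>\<mu>)) (at 0)"
    by (simp add: add.assoc axis_add)
  then have d: "((\<lambda>r. \<integral>x. \<eta> (x + axis j (r - s)) * v x \<partial>\<mu>) has_real_derivative
      - (\<integral>x. \<eta> x * h (x + axis j s) \<partial>\<mu>)) (at (s - s))" by simp
  have "((\<lambda>t. s - t) has_real_derivative - 1) (at s)"
    by (auto intro!: derivative_eq_intros)
  from DERIV_chain2[OF d this] have "((\<lambda>t. \<integral>x. \<eta> (x + axis j (- t)) * v x \<partial>\<mu>) has_real_derivative
      (\<integral>x. \<eta> x * h (x + axis j s) \<partial>\<mu>)) (at s)" by simp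
  then show ?thesis by (simp add: shift_pairing[OF \<eta>L v(1) j])
qed

text \<open>
  Approximate \<open>u\<close> by test functions. The derivatives of the pairings converge uniformly in \<open>s\<close>, since
  the translates of \<open>h\<close> all have the same norm; hence the limit of the pairings is differentiable and its
  derivative is the limit of the derivatives.
\<close>

lemma shift_pairing_deriv:
  assumes u: "square_integrable \<mu> u" and v: "v \<in> L2" "h \<in> L2" "is_weak_partial j v h" and j: "j \<noteq> 1"
  shows "((\<lambda>s. \<integral>x. u x * v (x + axis j s) \<partial>\<mu>) has_real_derivative
    (\<integral>x. u x * h (x + axis j s) \<partial>\<mu>)) (at s)"
proof -
  obtain F where F: "\<And>n. F n \<in> test_functions" "L2_tendsto \<mu> F u" using obtain_test_sequence[OF u] by blast
  define H where "H = sqrt (\<integral>x. (h x)\<^sup>2 \<partial>\<mu>)"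
  have sv: "square_integrable \<mu> (\<lambda>x. v (x + axis j s))" "square_integrable \<mu> (\<lambda>x. h (x + axis j s))" for s
    by (intro L2_square_integrable L2_shift v j)+
  have lim: "(\<lambda>n. \<integral>x. F n x * v (x + axis j s) \<partial>\<mu>) \<longlonglongrightarrow> (\<integral>x. u x * v (x + axis j s) \<partial>\<mu>)" for s
    by (rule L2_tendsto_pairing[OF F(2) sv(1)])
  have err: "\<bar>(\<integral>x. F n x * h (x + axis j s) \<partial>\<mu>) - (\<integral>x. u x * h (x + axis j s) \<partial>\<mu>)\<bar>
      \<le> sqrt (\<integral>x. (F n x - u x)\<^sup>2 \<partial>\<mu>) * H" for n s
    using L2_tendsto_pairing_error[OF F(2) sv(2), of n s] by (simp add: H_def L2_shift(2)[OF v(2) j])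
  have err0: "(\<lambda>n. sqrt (\<integral>x. (F n x - u x)\<^sup>2 \<partial>\<mu>) * H) \<longlonglongrightarrow> 0"
  proof -
    have "(\<lambda>n. sqrt (\<integral>x. (F n x - u x)\<^sup>2 \<partial>\<mu>) * H) \<longlonglongrightarrow> sqrt 0 * H"
      by (intro tendsto_intros) (use F(2) in \<open>simp add: L2_tendsto_def\<close>)
    then show ?thesis by simp
  qed
  have "\<exists>g. \<forall>s\<in>UNIV. (\<lambda>n. \<integral>x. F n x * v (x + axis j s) \<partial>\<mu>) \<longlonglongrightarrow> g s \<and>
      (g has_derivative (\<lambda>t. (\<integral>x. u x * h (x + axis j s) \<partial>\<mu>) * t)) (at s within UNIV)"
  proof (rule has_derivative_sequence)
    show "((\<lambda>s. \<integral>x. F n x * v (x + axis j s) \<partial>\<mu>) has_derivative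
        (\<lambda>t. (\<integral>x. F n x * h (x + axis j s) \<partial>\<mu>) * t)) (at s within UNIV)" for n s
      using test_pairing_deriv[OF F(1) v j] by (simp add: has_field_derivative_def)
    show "\<forall>\<^sub>F n in sequentially. \<forall>s\<in>UNIV. \<forall>t. norm ((\<integral>x. F n x * h (x + axis j s) \<partial>\<mu>) * t
        - (\<integral>x. u x * h (x + axis j s) \<partial>\<mu>) * t) \<le> e * norm t" if "e > 0" for e
      using order_tendstoD(2)[OF err0 that]
    proof eventually_elim
      case (elim n)
      show ?case
      proof (intro ballI allI)
        fix s t :: real
        have "\<bar>(\<integral>x. F n x * h (x + axis j s) \<partial>\<mu>) - (\<integral>x. u x * h (x + axis j s) \<partial>\<mu>)\<bar> \<le> e"
          using err[of n s] elim by linarith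
        then show "norm ((\<integral>x. F n x * h (x + axis j s) \<partial>\<mu>) * t - (\<integral>x. u x * h (x + axis j s) \<partial>\<mu>) * t) \<le> e * norm t"
          by (simp add: left_diff_distrib[symmetric] abs_mult mult_right_mono)
      qed
    qed
    show "(\<lambda>n. \<integral>x. F n x * v (x + axis j 0) \<partial>\<mu>) \<longlonglongrightarrow> (\<integral>x. u x * v (x + axis j 0) \<partial>\<mu>)" by (rule lim)
  qed auto
  then obtain g where g: "\<And>s. (\<lambda>n. \<integral>x. F n x * v (x + axis j s) \<partial>\<mu>) \<longlonglongrightarrow> g s"
    "\<And>s. (g has_derivative (\<lambda>t. (\<integral>x. u x * h (x + axis j s) \<partial>\<mu>) * t)) (at s)" by auto
  have "g = (\<lambda>s. \<integral>x. u x * v (x + axis j s) \<partial>\<mu>)"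
    by (rule ext) (rule LIMSEQ_unique[OF g(1) lim])
  then show ?thesis using g(2)[of s] by (simp add: has_field_derivative_def)
qed

text \<open>
  The same kind of pairing, differentiated through its first factor: moving the translation to
  \<open>u\<close> reverses its direction, whence the sign.
\<close>

lemma reflected_shift_pairing_deriv_0:
  assumes u: "u \<in> L2" "g \<in> L2" "is_weak_partial j u g" and w: "w \<in> L2" and j: "j \<noteq> 1"
  shows "((\<lambda>s. \<integral>x. u x * w (x + axis j s) \<partial>\<mu>) has_real_derivative - (\<integral>x. g x * w x \<partial>\<mu>)) (at 0)"
proof -
  have d: "((\<lambda>s. \<integral>x. w x * u (x + axis j s) \<partial>\<mu>) has_real_derivative
      (\<integral>x. w x * g (x + axis j 0) \<partial>\<mu>)) (at (- 0))"
    using shift_pairing_deriv[OF L2_square_integrable[OF w] u j, of 0] by simp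
  have "((\<lambda>t. - t) has_real_derivative - 1) (at (0::real))" by (auto intro!: derivative_eq_intros)
  from DERIV_chain2[OF d this]
  have "((\<lambda>s. \<integral>x. w x * u (x + axis j (- s)) \<partial>\<mu>) has_real_derivative - (\<integral>x. g x * w x \<partial>\<mu>)) (at 0)"
    by (simp add: axis_0 mult.commute)
  then show ?thesis by (simp add: shift_pairing[OF u(1) w j] mult.commute)
qed

text \<open>
  Both sides are the derivative at \<open>s = 0\<close> of \<open>\<integral> u(x) v(x + s e\<^sub>j) dx\<close>, up to the same sign.
\<close>

theorem tangential_integration_by_parts:
  assumes u: "u \<in> L2" "g \<in> L2" "is_weak_partial j u g"
    and v: "v \<in> L2" "h \<in> L2" "is_weak_partial j v h" and j: "j \<noteq> 1"
  shows "(\<integral>x. g x * v x \<partial>\<mu>) = - (\<integral>x. u x * h x \<partial>\<mu>)"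
proof -
  have "(\<integral>x. u x * h (x + axis j 0) \<partial>\<mu>) = - (\<integral>x. g x * v x \<partial>\<mu>)"
    by (rule DERIV_unique[OF shift_pairing_deriv[OF L2_square_integrable[OF u(1)] v j]
          reflected_shift_pairing_deriv_0[OF u v(1) j]])
  then show ?thesis by (simp add: axis_0)
qed

text \<open>
  The equality of mixed second derivatives in a form that involves first derivatives only.
  Integration by parts in direction \<open>i\<close> is a hypothesis, since its justification depends on whether
  \<open>i\<close> is tangential or normal. It is applied to all translates of \<open>v\<close> in direction \<open>j\<close>, and the resulting
  identity between functions of the translation parameter is differentiated at zero.
\<close>

theorem exchange_derivatives:
  assumes u: "u \<in> L2" "g\<^sub>i \<in> L2" "g\<^sub>j \<in> L2" "is_weak_partial j u g\<^sub>j"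
    and v: "v \<in> L2" "h\<^sub>i \<in> L2" "h\<^sub>j \<in> L2" "is_weak_partial i v h\<^sub>i" "is_weak_partial j v h\<^sub>j"
    and j: "j \<noteq> 1"
    and parts: "\<And>w k. w \<in> L2 \<Longrightarrow> k \<in> L2 \<Longrightarrow> is_weak_partial i w k \<Longrightarrow>
      (\<integral>x. g\<^sub>i x * w x \<partial>\<mu>) = - (\<integral>x. u x * k x \<partial>\<mu>)"
  shows "(\<integral>x. g\<^sub>i x * h\<^sub>j x \<partial>\<mu>) = (\<integral>x. g\<^sub>j x * h\<^sub>i x \<partial>\<mu>)"
proof -
  have eq: "(\<integral>x. g\<^sub>i x * v (x + axis j s) \<partial>\<mu>) = - (\<integral>x. u x * h\<^sub>i (x + axis j s) \<partial>\<mu>)" for s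
    by (rule parts) (intro L2_shift is_weak_partial_shift v j)+
  have "((\<lambda>s. \<integral>x. g\<^sub>i x * v (x + axis j s) \<partial>\<mu>) has_real_derivative
      (\<integral>x. g\<^sub>i x * h\<^sub>j (x + axis j 0) \<partial>\<mu>)) (at 0)"
    by (rule shift_pairing_deriv[OF L2_square_integrable[OF u(2)] v(1,3,5) j])
  then have d1: "((\<lambda>s. - (\<integral>x. u x * h\<^sub>i (x + axis j s) \<partial>\<mu>)) has_real_derivative
      (\<integral>x. g\<^sub>i x * h\<^sub>j x \<partial>\<mu>)) (at 0)"
    by (simp add: eq axis_0)
  have d2: "((\<lambda>s. - (\<integral>x. u x * h\<^sub>i (x + axis j s) \<partial>\<mu>)) has_real_derivative
      - (- (\<integral>x. g\<^sub>j x * h\<^sub>i x \<partial>\<mu>))) (at 0)"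
    by (rule DERIV_minus[OF reflected_shift_pairing_deriv_0[OF u(1,3,4) v(2) j]])
  show ?thesis using DERIV_unique[OF d1 d2] by simp
qed

section \<open>The normal direction: divergence theorem and Hardy's inequality\<close>

lemma prod_Basis_cart:
  fixes f :: "real ^ 'n \<Rightarrow> 'b::comm_monoid_mult"
  shows "(\<Prod>b\<in>Basis. f b) = (\<Prod>i\<in>UNIV. f (axis i 1))"
proof -
  have B: "Basis = range (\<lambda>i. axis i 1 :: real ^ 'n)" by (auto simp: Basis_vec_def)
  have "inj (\<lambda>i. axis i 1 :: real ^ 'n)" by (auto simp: inj_def axis_eq_axis)
  from prod.reindex[OF this, of f] show ?thesis by (simp only: B comp_def)
qed

lemma prod_UNIV_3: "(\<Prod>i\<in>UNIV. f i) = f 1 * (f 2 * (f (3 :: 3) :: real))"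
proof -
  have "(1::3) \<noteq> 2" "(1::3) \<noteq> 3" "(2::3) \<noteq> 3" by simp_all
  then show ?thesis unfolding UNIV_3 by (simp only: prod.insert prod.empty finite.intros insert_iff empty_iff simp_thms mult_1_right)
qed

lemma boundary_point_nth [simp]:
  "boundary_point a y $ 1 = a" "boundary_point a y $ 2 = y $ 1" "boundary_point a y $ 3 = y $ 2"
  by (simp_all add: boundary_point_def)

lemma boundary_point_eq: "boundary_point a y = a *\<^sub>R axis 1 1 + y $ 1 *\<^sub>R axis 2 1 + y $ 2 *\<^sub>R axis 3 1"
  by (simp add: vec_eq_iff forall_3 axis_def)

lemma continuous_boundary_point [continuous_intros]:
  assumes "continuous_on S f" "continuous_on S g"
  shows "continuous_on S (\<lambda>x. boundary_point (f x) (g x))"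
  unfolding boundary_point_eq by (intro continuous_intros assms)

text \<open>
  The parametrisation of \<open>\<real>\<^sup>3\<close> by \<open>\<real> \<times> \<real>\<^sup>2\<close> preserves Lebesgue measure, because it maps boxes to boxes of
  the same volume. This gives access to Fubini's theorem for iterated integrals along the normal.
\<close>

lemma distr_boundary_point:
  "distr (lborel \<Otimes>\<^sub>M lborel) lborel (\<lambda>(a, y). boundary_point a y) = lborel"
proof (rule lborel_eqI[symmetric])
  let ?g = "\<lambda>(a, y). boundary_point a y"
  have m: "?g \<in> measurable (lborel \<Otimes>\<^sub>M lborel) lborel"
  proof -
    have "?g \<in> borel_measurable borel"
      by (intro borel_measurable_continuous_onI) (simp add: case_prod_beta continuous_intros)
    then show ?thesis by (simp add: lborel_prod)
  qed
  fix l u :: "real ^ 3" assume lu: "\<And>b. b \<in> Basis \<Longrightarrow> l \<bullet> b \<le> u \<bullet> b"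
  have lu': "l $ i \<le> u $ i" for i using lu[of "axis i 1"] by (simp add: inner_axis)
  define l2 u2 :: "real ^ 2" where "l2 = vector [l $ 2, l $ 3]" and "u2 = vector [u $ 2, u $ 3]"
  have pre: "?g -` box l u \<inter> space (lborel \<Otimes>\<^sub>M lborel) = box (l $ 1) (u $ 1) \<times> box l2 u2"
    by (auto simp: mem_box_cart forall_3 forall_2 l2_def u2_def space_pair_measure)
  have "emeasure (distr (lborel \<Otimes>\<^sub>M lborel) lborel ?g) (box l u)
      = emeasure (lborel \<Otimes>\<^sub>M lborel) (box (l $ 1) (u $ 1) \<times> box l2 u2)"
    by (subst emeasure_distr[OF m]) (simp_all add: pre)
  also have "\<dots> = emeasure lborel (box (l $ 1) (u $ 1)) * emeasure lborel (box l2 u2)"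
    by (rule lborel.emeasure_pair_measure_Times) auto
  also have "emeasure lborel (box l2 u2) = (\<Prod>b\<in>Basis. (u2 - l2) \<bullet> b)"
  proof (rule emeasure_lborel_box)
    fix b :: "real ^ 2" assume "b \<in> Basis"
    then obtain i where "b = axis i 1" by (auto simp: Basis_vec_def)
    then have "l2 \<bullet> b = l2 $ i" "u2 \<bullet> b = u2 $ i" by (simp_all add: inner_axis)
    then show "l2 \<bullet> b \<le> u2 \<bullet> b"
      using exhaust_2[of i] lu'[of 2] lu'[of 3] by (elim disjE) (simp_all add: l2_def u2_def)
  qed
  also have "\<dots> = (u $ 2 - l $ 2) * (u $ 3 - l $ 3)"
    by (simp add: prod_Basis_cart UNIV_2 inner_axis l2_def u2_def)
  also have "emeasure lborel (box (l $ 1) (u $ 1)) = u $ 1 - l $ 1"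
    using lu' by (subst emeasure_lborel_box) auto
  also have "ennreal (u $ 1 - l $ 1) * ennreal ((u $ 2 - l $ 2) * (u $ 3 - l $ 3))
      = ennreal ((u $ 1 - l $ 1) * ((u $ 2 - l $ 2) * (u $ 3 - l $ 3)))"
    by (rule ennreal_mult[symmetric]) (use lu' in \<open>auto intro!: mult_nonneg_nonneg\<close>)
  also have "(u $ 1 - l $ 1) * ((u $ 2 - l $ 2) * (u $ 3 - l $ 3)) = (\<Prod>b\<in>Basis. (u - l) \<bullet> b)"
    by (simp add: prod_Basis_cart prod_UNIV_3 inner_axis)
  finally show "emeasure (distr (lborel \<Otimes>\<^sub>M lborel) lborel ?g) (box l u) = (\<Prod>b\<in>Basis. (u - l) \<bullet> b)" .
qed simp

lemma integral_lebesgue_on_continuous: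
  fixes f :: "'a::euclidean_space \<Rightarrow> real"
  assumes "S \<in> sets borel" "continuous_on S f"
  shows "integral\<^sup>L (lebesgue_on S) f = (\<integral>x. indicator S x * f x \<partial>lborel)"
proof -
  have m: "(\<lambda>x. indicator S x *\<^sub>R f x) \<in> borel_measurable borel"
    by (rule borel_measurable_continuous_on_indicator[OF assms])
  have "integral\<^sup>L (lebesgue_on S) f = (\<integral>x. indicator S x *\<^sub>R f x \<partial>lebesgue)"
    by (rule integral_restrict_space) (use assms in \<open>simp add: sets_completionI_sets\<close>)
  also have "\<dots> = (\<integral>x. indicator S x *\<^sub>R f x \<partial>lborel)"
    by (rule integral_completion) (use m in simp)
  finally show ?thesis by simp
qed

lemma square_borel: "square \<in> sets borel"
  unfolding square_def by measurable

lemma boundary_point_mem: "y \<in> square \<Longrightarrow> 0 \<le> t \<Longrightarrow> t \<le> 1 \<Longrightarrow> boundary_point t y \<in> cbox 0 1"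
  by (auto simp: square_def mem_box_cart forall_3)

text \<open>
  Fubini's theorem and, on each line in the normal direction, the fundamental theorem of calculus.
\<close>

theorem normal_divergence:
  fixes F D :: "real ^ 3 \<Rightarrow> real"
  assumes F: "continuous_on (cbox 0 1) F" and D: "continuous_on (cbox 0 1) D"
    and der: "\<And>t y. y \<in> square \<Longrightarrow> 0 \<le> t \<Longrightarrow> t \<le> 1 \<Longrightarrow>
      ((\<lambda>t. F (boundary_point t y)) has_real_derivative D (boundary_point t y)) (at t within {0..1})"
  shows "(\<integral>x. D x \<partial>\<mu>) = (\<integral>y. F (boundary_point 1 y) - F (boundary_point 0 y) \<partial>lebesgue_on square)"
proof -
  define E where "E = (\<lambda>x. indicator cell x * D x)"
  have Dc: "continuous_on cell D" by (rule continuous_on_subset[OF D cell_subset])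
  have E: "E \<in> borel_measurable borel"
    using borel_measurable_continuous_on_indicator[OF cell_borel Dc] by (simp add: E_def)
  have Eint: "integrable lborel E"
  proof -
    have "integrable \<mu> D" by (rule square_integrable_cell_integrable[OF continuous_square_integrable[OF D]])
    then have "integrable lebesgue E"
      using cell_lebesgue by (simp add: integrable_restrict_space E_def)
    then show ?thesis using E by (simp add: integrable_completion)
  qed
  have g: "(\<lambda>(a, y). boundary_point a y) \<in> measurable (lborel \<Otimes>\<^sub>M lborel) lborel"
  proof -
    have "(\<lambda>(a, y). boundary_point a y) \<in> borel_measurable borel"
      by (intro borel_measurable_continuous_onI) (simp add: case_prod_beta continuous_intros)
    then show ?thesis by (simp add: lborel_prod)
  qed
  have int: "integrable (lborel \<Otimes>\<^sub>M lborel) (\<lambda>(a, y). E (boundary_point a y))"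
  proof -
    have "integrable (distr (lborel \<Otimes>\<^sub>M lborel) lborel (\<lambda>(a, y). boundary_point a y)) E"
      unfolding distr_boundary_point by (rule Eint)
    from integrable_distr[OF g this] show ?thesis by (simp add: case_prod_unfold)
  qed
  have inner: "(\<integral>t. E (boundary_point t y) \<partial>lborel)
      = indicator square y * (F (boundary_point 1 y) - F (boundary_point 0 y))" for y
  proof (cases "y \<in> square")
    case True
    have "(\<integral>t. E (boundary_point t y) \<partial>lborel) = (\<integral>t. indicator {0..1} t *\<^sub>R D (boundary_point t y) \<partial>lborel)"
    proof (rule integral_cong_AE)
      have c: "(\<lambda>t. boundary_point t y) \<in> borel_measurable borel"
        by (intro borel_measurable_continuous_onI continuous_intros)
      show "(\<lambda>t. E (boundary_point t y)) \<in> borel_measurable lborel"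
        using measurable_compose[OF c E] by simp
      have "continuous_on {0..1} (\<lambda>t. D (boundary_point t y))"
        by (rule continuous_on_compose2[OF D]) (use True boundary_point_mem in \<open>auto intro!: continuous_intros\<close>)
      from borel_measurable_continuous_on_indicator[OF _ this]
      show "(\<lambda>t. indicator {0..1} t *\<^sub>R D (boundary_point t y)) \<in> borel_measurable lborel" by simp
      have "AE t in lborel. t \<noteq> (0::real)" "AE t in lborel. t \<noteq> (1::real)" by (rule AE_lborel_singleton)+
      then show "AE t in lborel. E (boundary_point t y) = indicator {0..1} t *\<^sub>R D (boundary_point t y)"
        by eventually_elim (use True in \<open>auto simp: E_def cell_def square_def indicator_def\<close>)
    qed
    also have "\<dots> = F (boundary_point 1 y) - F (boundary_point 0 y)"
    proof (rule integral_FTC_Icc)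
      show "((\<lambda>t. F (boundary_point t y)) has_vector_derivative D (boundary_point t y)) (at t within {0..1})"
        if "0 \<le> t" "t \<le> 1" for t
        using der[OF True that] by (simp add: has_real_derivative_iff_has_vector_derivative)
      show "continuous_on {0..1} (\<lambda>t. D (boundary_point t y))"
        by (rule continuous_on_compose2[OF D]) (use True boundary_point_mem in \<open>auto intro!: continuous_intros\<close>)
    qed simp
    finally show ?thesis using True by simp
  next
    case False
    then have "E (boundary_point t y) = 0" for t by (auto simp: E_def cell_def square_def)
    then show ?thesis using False by simp
  qed
  have "(\<integral>x. D x \<partial>\<mu>) = (\<integral>x. E x \<partial>lborel)"
    unfolding E_def by (rule integral_lebesgue_on_continuous[OF cell_borel Dc])
  also have "\<dots> = (\<integral>x. E x \<partial>distr (lborel \<Otimes>\<^sub>M lborel) lborel (\<lambda>(a, y). boundary_point a y))"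
    unfolding distr_boundary_point ..
  also have "\<dots> = (\<integral>p. E ((\<lambda>(a, y). boundary_point a y) p) \<partial>(lborel \<Otimes>\<^sub>M lborel))"
    by (rule integral_distr[OF g]) (use E in simp)
  also have "\<dots> = (\<integral>p. (\<lambda>(a, y). E (boundary_point a y)) p \<partial>(lborel \<Otimes>\<^sub>M lborel))"
    by (simp add: case_prod_beta)
  also have "\<dots> = (\<integral>y. (\<integral>t. E (boundary_point t y) \<partial>lborel) \<partial>lborel)"
    by (rule lborel_pair.integral_snd[OF int, symmetric])
  also have "\<dots> = (\<integral>y. indicator square y * (F (boundary_point 1 y) - F (boundary_point 0 y)) \<partial>lborel)"
    by (simp add: inner)
  also have "\<dots> = (\<integral>y. F (boundary_point 1 y) - F (boundary_point 0 y) \<partial>lebesgue_on square)"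
  proof (rule integral_lebesgue_on_continuous[OF square_borel, symmetric])
    have "continuous_on square (\<lambda>y. F (boundary_point t y))" if "0 \<le> t" "t \<le> 1" for t
      by (rule continuous_on_compose2[OF F]) (use that boundary_point_mem in \<open>auto intro!: continuous_intros\<close>)
    then show "continuous_on square (\<lambda>y. F (boundary_point 1 y) - F (boundary_point 0 y))"
      by (intro continuous_intros) auto
  qed
  finally show ?thesis .
qed

lemma smooth_normal_derivative:
  assumes "\<And>x. f differentiable (at x)"
  shows "((\<lambda>t. f (boundary_point t y)) has_real_derivative classical_partial 1 f (boundary_point t y)) (at t)"
proof -
  have "boundary_point 0 y + s *\<^sub>R axis 1 1 = boundary_point s y" for s
    by (simp add: boundary_point_eq)
  then show ?thesis using line_derivative[of f "boundary_point 0 y" t 1] assms by simp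
qed

lemma smooth_periodic_differentiable: "f \<in> smooth_periodic \<Longrightarrow> f differentiable (at x)"
  using smooth_periodic_C_k[of f 1] by simp

lemma smooth_periodic_continuous:
  assumes "f \<in> smooth_periodic"
  shows "continuous_on S f" "continuous_on S (classical_partial j f)"
  by (rule continuous_on_subset[OF C_k_continuous[OF smooth_periodic_C_k[OF assms]] subset_UNIV],
      rule continuous_on_subset[OF continuous_partial[OF smooth_periodic_C_k[OF assms]] subset_UNIV])

text \<open>
  The boundary terms of the product with a test function vanish.
\<close>

lemma smooth_weak_normal_partial:
  assumes f: "f \<in> smooth_periodic"
  shows "is_weak_partial 1 f (classical_partial 1 f)"
  unfolding is_weak_partial_def
proof
  fix \<phi> assume \<phi>: "\<phi> \<in> test_functions"
  then have \<phi>s: "\<phi> \<in> smooth_periodic" by (rule test_function_smooth)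
  let ?D = "\<lambda>x. f x * classical_partial 1 \<phi> x + classical_partial 1 f x * \<phi> x"
  have 0: "\<phi> (boundary_point 0 y) = 0" "\<phi> (boundary_point 1 y) = 0" for y
    using \<phi> by (auto simp: test_functions_def)
  have "(\<integral>x. ?D x \<partial>\<mu>) = (\<integral>y. f (boundary_point 1 y) * \<phi> (boundary_point 1 y)
      - f (boundary_point 0 y) * \<phi> (boundary_point 0 y) \<partial>lebesgue_on square)"
  proof (rule normal_divergence[where F = "\<lambda>x. f x * \<phi> x"])
    fix t :: real and y
    show "((\<lambda>t. f (boundary_point t y) * \<phi> (boundary_point t y)) has_real_derivative
        ?D (boundary_point t y)) (at t within {0..1})"
      by (rule has_field_derivative_at_within)
        (auto intro!: derivative_eq_intros smooth_normal_derivative smooth_periodic_differentiable f \<phi>s)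
  qed (intro continuous_on_add continuous_on_mult continuous_on_power continuous_on_const smooth_periodic_continuous[OF f]
      smooth_periodic_continuous[OF \<phi>s])+
  then have "(\<integral>x. ?D x \<partial>\<mu>) = 0" by (simp add: 0)
  moreover have "integrable \<mu> (\<lambda>x. f x * classical_partial 1 \<phi> x)" "integrable \<mu> (\<lambda>x. classical_partial 1 f x * \<phi> x)"
    by (intro square_integrable_mult L2_square_integrable smooth_periodic_L2 smooth_periodic_partial_L2 f \<phi>s)+
  ultimately show "(\<integral>x. f x * classical_partial 1 \<phi> x \<partial>\<mu>) = - (\<integral>x. classical_partial 1 f x * \<phi> x \<partial>\<mu>)"
    by simp
qed

lemma L2_boundary_norm_square:
  assumes "f \<in> smooth_periodic"
  shows "(L2_boundary_norm f)\<^sup>2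
      = (\<integral>y. (f (boundary_point 1 y))\<^sup>2 + (f (boundary_point 0 y))\<^sup>2 \<partial>lebesgue_on square)"
proof -
  have i: "integrable (lebesgue_on square) (\<lambda>y. (f (boundary_point a y))\<^sup>2)" for a
  proof -
    have sub: "square \<subseteq> cbox 0 1" by (auto simp: square_def mem_box_cart forall_2)
    have c: "continuous_on (cbox 0 1) (\<lambda>y. (f (boundary_point a y))\<^sup>2)"
      by (intro continuous_intros continuous_on_compose2[OF smooth_periodic_continuous(1)[OF assms, of UNIV]]) auto
    have "set_integrable lebesgue (cbox 0 1) (\<lambda>y. (f (boundary_point a y))\<^sup>2)"
      using continuous_imp_integrable[OF c] by (simp add: set_integrable_def integrable_restrict_space)
    from set_integrable_subset[OF this _ sub] show ?thesis
      using square_borel by (simp add: set_integrable_def integrable_restrict_space sets_completionI_sets)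
  qed
  have "(L2_boundary_norm f)\<^sup>2 = (\<integral>y. (f (boundary_point 0 y))\<^sup>2 \<partial>lebesgue_on square)
      + (\<integral>y. (f (boundary_point 1 y))\<^sup>2 \<partial>lebesgue_on square)"
    by (simp add: L2_boundary_norm_def add_nonneg_nonneg)
  then show ?thesis using i by simp
qed

text \<open>
  The right-hand side is the normal derivative of \<open>W p\<^sup>2\<close> for a function \<open>p\<close> with normal derivative
  \<open>q\<close> and the weight \<open>W = (2 t - 1) / \<sigma>\<close>. It bounds \<open>(p/\<sigma>)\<^sup>2\<close> since Young's inequality costs only a quarter of
  \<open>W\<^sup>2 p\<^sup>2\<close>, and \<open>2 \<sigma> + 3/4 (2 t - 1)\<^sup>2 = 3/4 - t (1 - t) + 2 d\<close> is at least \<open>1/2\<close>.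
\<close>

lemma Hardy_pointwise:
  fixes t d p q :: real
  assumes t: "0 \<le> t" "t \<le> 1" and d: "0 < d"
  defines "\<sigma> \<equiv> t * (1 - t) + d"
  shows "1 / 2 * (p / \<sigma>)\<^sup>2 - 4 * q\<^sup>2
    \<le> (2 * \<sigma> + (2 * t - 1)\<^sup>2) / \<sigma>\<^sup>2 * p\<^sup>2 + 2 * ((2 * t - 1) / \<sigma>) * p * q"
proof -
  define w where "w = p / \<sigma>"
  define S where "S = (2 * t - 1)\<^sup>2"
  define B where "B = 2 * (2 * t - 1) * w * q"
  have eq: "(2 * \<sigma> + S) / \<sigma>\<^sup>2 * p\<^sup>2 + 2 * ((2 * t - 1) / \<sigma>) * p * q = (2 * \<sigma> + S) * w\<^sup>2 + B"
    by (simp add: w_def B_def power_divide)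
  have "0 \<le> ((2 * t - 1) * w / 2 + 2 * q)\<^sup>2" by simp
  then have "- (S * w\<^sup>2 / 4) - 4 * q\<^sup>2 \<le> B"
    by (simp add: S_def B_def power2_eq_square algebra_simps)
  moreover have "1 / 2 * w\<^sup>2 \<le> (2 * \<sigma> + 3 / 4 * S) * w\<^sup>2"
  proof (rule mult_right_mono)
    have "0 \<le> (2 * t - 1)\<^sup>2" by simp
    then show "1 / 2 \<le> 2 * \<sigma> + 3 / 4 * S"
      using d t unfolding \<sigma>_def S_def by (simp add: power2_eq_square algebra_simps)
  qed simp
  ultimately have "1 / 2 * w\<^sup>2 - 4 * q\<^sup>2 \<le> (2 * \<sigma> + S) * w\<^sup>2 + B"
    by (simp add: distrib_right)
  then show ?thesis unfolding eq[unfolded S_def, symmetric] S_def by (simp only: w_def)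
qed

text \<open>
  Hardy's inequality for a function that need not vanish on the boundary, regularised by \<open>d\<close>: the
  boundary values enter with the weight \<open>W(1) = - W(0) = 1/d\<close>. They are harmless if they tend to zero while
  \<open>d\<close> is fixed.
\<close>

lemma Hardy_smooth:
  assumes f: "f \<in> smooth_periodic" and d: "0 < d"
  shows "(\<integral>x. (f x / (x $ 1 * (1 - x $ 1) + d))\<^sup>2 \<partial>\<mu>)
    \<le> 2 / d * (L2_boundary_norm f)\<^sup>2 + 8 * (\<integral>x. (classical_partial 1 f x)\<^sup>2 \<partial>\<mu>)"
proof -
  define \<sigma> where "\<sigma> t = t * (1 - t) + d" for t :: real
  define W where "W t = (2 * t - 1) / \<sigma> t" for t
  define V where "V t = (2 * \<sigma> t + (2 * t - 1)\<^sup>2) / (\<sigma> t)\<^sup>2" for t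
  let ?f' = "classical_partial 1 f"
  let ?D = "\<lambda>x. V (x $ 1) * (f x)\<^sup>2 + 2 * W (x $ 1) * f x * ?f' x"
  have pos: "\<sigma> t > 0" if "0 \<le> t" "t \<le> 1" for t
    unfolding \<sigma>_def using that d by (intro add_nonneg_pos mult_nonneg_nonneg) auto
  have pos': "\<sigma> (x $ 1) > 0" if "x \<in> cbox 0 1" for x
    using pos that by (auto simp: mem_box_cart)
  then have nz: "\<sigma> (x $ 1) \<noteq> 0" if "x \<in> cbox 0 1" for x
    using that by force
  note cf = smooth_periodic_continuous[OF f]
  have c\<sigma>: "continuous_on (cbox 0 1) (\<lambda>x. \<sigma> (x $ 1))"
    unfolding \<sigma>_def by (intro continuous_intros)
  have cV: "continuous_on (cbox 0 1) (\<lambda>x. V (x $ 1))" and cW: "continuous_on (cbox 0 1) (\<lambda>x. W (x $ 1))"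
    unfolding V_def W_def
    by (rule continuous_on_divide, intro continuous_intros c\<sigma>, intro continuous_intros c\<sigma>, simp add: nz)+
  have W': "(W has_real_derivative V t) (at t)" if "0 \<le> t" "t \<le> 1" for t
  proof -
    have "(\<sigma> has_real_derivative 1 - 2 * t) (at t)"
      unfolding \<sigma>_def by (auto intro!: derivative_eq_intros)
    moreover have "((\<lambda>t. 2 * t - 1) has_real_derivative 2) (at t)"
      by (auto intro!: derivative_eq_intros)
    ultimately have "(W has_real_derivative (2 * \<sigma> t - (2 * t - 1) * (1 - 2 * t)) / (\<sigma> t * \<sigma> t)) (at t)"
      unfolding W_def using pos[OF that] by (intro DERIV_divide) auto
    also have "2 * \<sigma> t - (2 * t - 1) * (1 - 2 * t) = 2 * \<sigma> t + (2 * t - 1)\<^sup>2"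
      by (simp add: power2_eq_square algebra_simps)
    finally show ?thesis by (simp add: V_def power2_eq_square)
  qed
  have "(\<integral>x. ?D x \<partial>\<mu>) = (\<integral>y. W (boundary_point 1 y $ 1) * (f (boundary_point 1 y))\<^sup>2
      - W (boundary_point 0 y $ 1) * (f (boundary_point 0 y))\<^sup>2 \<partial>lebesgue_on square)"
  proof (rule normal_divergence[where F = "\<lambda>x. W (x $ 1) * (f x)\<^sup>2"])
    fix t :: real and y assume t: "0 \<le> t" "t \<le> 1"
    show "((\<lambda>t. W (boundary_point t y $ 1) * (f (boundary_point t y))\<^sup>2) has_real_derivative
        ?D (boundary_point t y)) (at t within {0..1})"
      using has_field_derivative_at_within[OF DERIV_mult[OF W'[OF t] DERIV_power[OF
          smooth_normal_derivative[OF smooth_periodic_differentiable[OF f]], where n = 2]]]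
      by (simp add: mult_ac)
  qed (intro continuous_on_add continuous_on_mult continuous_on_power continuous_on_const cf cV cW)+
  also have "\<dots> = (\<integral>y. ((f (boundary_point 1 y))\<^sup>2 + (f (boundary_point 0 y))\<^sup>2) / d \<partial>lebesgue_on square)"
    by (intro Bochner_Integration.integral_cong) (auto simp: W_def \<sigma>_def add_divide_distrib)
  also have "\<dots> = (L2_boundary_norm f)\<^sup>2 / d"
    by (simp add: L2_boundary_norm_square[OF f])
  finally have D: "(\<integral>x. ?D x \<partial>\<mu>) = (L2_boundary_norm f)\<^sup>2 / d" .
  have sq: "square_integrable \<mu> (\<lambda>x. f x / \<sigma> (x $ 1))" "square_integrable \<mu> ?f'"
    by (rule continuous_square_integrable, rule continuous_on_divide[OF cf(1) c\<sigma>], simp add: nz)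
      (rule continuous_square_integrable, rule cf)
  have iD: "integrable \<mu> ?D"
    by (intro square_integrable_cell_integrable continuous_square_integrable
        continuous_on_add continuous_on_mult continuous_on_power continuous_on_const cf cV cW)
  have "(\<integral>x. 1 / 2 * (f x / \<sigma> (x $ 1))\<^sup>2 - 4 * (?f' x)\<^sup>2 \<partial>\<mu>) \<le> (\<integral>x. ?D x \<partial>\<mu>)"
  proof (rule integral_mono[OF _ iD])
    show "integrable \<mu> (\<lambda>x. 1 / 2 * (f x / \<sigma> (x $ 1))\<^sup>2 - 4 * (?f' x)\<^sup>2)"
      using sq by (auto simp: square_integrable_def)
    fix x assume "x \<in> space \<mu>"
    then show "1 / 2 * (f x / \<sigma> (x $ 1))\<^sup>2 - 4 * (?f' x)\<^sup>2 \<le> ?D x"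
      unfolding V_def W_def \<sigma>_def by (intro Hardy_pointwise d) (auto simp: cell_def)
  qed
  also have "(\<integral>x. 1 / 2 * (f x / \<sigma> (x $ 1))\<^sup>2 - 4 * (?f' x)\<^sup>2 \<partial>\<mu>)
      = 1 / 2 * (\<integral>x. (f x / \<sigma> (x $ 1))\<^sup>2 \<partial>\<mu>) - 4 * (\<integral>x. (?f' x)\<^sup>2 \<partial>\<mu>)"
    using sq by (simp add: square_integrable_def)
  finally show ?thesis by (simp add: D \<sigma>_def)
qed

text \<open>
  The chosen representative can be replaced by any other weak partial derivative, by uniqueness.
\<close>

lemma weak_partial_spec:
  assumes "g \<in> L2" "is_weak_partial j f g"
  shows "weak_partial j f \<in> L2" "is_weak_partial j f (weak_partial j f)"
    "AE x in \<mu>. weak_partial j f x = g x"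
proof -
  have *: "weak_partial j f \<in> L2 \<and> is_weak_partial j f (weak_partial j f)"
    unfolding weak_partial_def by (rule someI[where x = g]) (use assms in simp)
  then show "weak_partial j f \<in> L2" "is_weak_partial j f (weak_partial j f)" by auto
  show "AE x in \<mu>. weak_partial j f x = g x"
    by (rule weak_partial_unique) (use * assms L2_square_integrable in auto)
qed

lemma is_weak_partial_diff:
  assumes "is_weak_partial j f f'" "is_weak_partial j g g'" "f \<in> L2" "f' \<in> L2" "g \<in> L2" "g' \<in> L2"
  shows "is_weak_partial j (\<lambda>x. f x - g x) (\<lambda>x. f' x - g' x)"
  unfolding is_weak_partial_def
proof
  fix \<phi> assume \<phi>: "\<phi> \<in> test_functions"
  note i = square_integrable_mult[OF L2_square_integrable test_square_integrable(1)[OF \<phi>]]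
    square_integrable_mult[OF L2_square_integrable test_square_integrable(2)[OF \<phi>]]
  show "(\<integral>x. (f x - g x) * classical_partial j \<phi> x \<partial>\<mu>) = - (\<integral>x. (f' x - g' x) * \<phi> x \<partial>\<mu>)"
    using assms(1,2) \<phi> i assms(3-6) by (simp add: left_diff_distrib is_weak_partial_def)
qed

lemma L2_diff: "f \<in> L2 \<Longrightarrow> g \<in> L2 \<Longrightarrow> (\<lambda>x. f x - g x) \<in> L2" for f g :: "real ^ 3 \<Rightarrow> real"
  by (auto simp: L2_real_iff periodic_on_def intro: square_integrable_diff)

lemma L2_norm_square: "(L2_norm f)\<^sup>2 = (\<integral>x. (norm (f x))\<^sup>2 \<partial>\<mu>)"
  unfolding L2_norm_def by (intro real_sqrt_pow2 integral_nonneg_AE) auto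

text \<open>
  Convergence of the chosen weak derivatives of \<open>\<phi> n - f\<close> is convergence of the
  classical derivatives of \<open>\<phi> n\<close> to \<open>g\<close>, because the classical derivative of a smooth function is its weak one.
\<close>

lemma zero_trace_approximation:
  assumes tr: "has_trace f (\<lambda>x. 0)" and g: "g \<in> L2" "is_weak_partial 1 f g"
  obtains \<phi> where "\<And>n. \<phi> n \<in> smooth_periodic" "L2_tendsto \<mu> \<phi> f"
    "L2_tendsto \<mu> (\<lambda>n. classical_partial 1 (\<phi> n)) g" "(\<lambda>n. L2_boundary_norm (\<phi> n)) \<longlonglongrightarrow> 0"
proof -
  obtain \<phi> where \<phi>: "\<And>n. \<phi> n \<in> smooth_periodic"
    and H: "(\<lambda>n. H1_norm (\<lambda>x. \<phi> n x - f x)) \<longlonglongrightarrow> 0"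
    and B: "(\<lambda>n. L2_boundary_norm (\<lambda>x. \<phi> n x - 0)) \<longlonglongrightarrow> 0"
    using tr unfolding has_trace_def by blast
  have f: "f \<in> L2" using tr by (simp add: has_trace_def H1_def)
  have "(\<lambda>n. (H1_norm (\<lambda>x. \<phi> n x - f x))\<^sup>2) \<longlonglongrightarrow> 0\<^sup>2" by (intro tendsto_intros H)
  then have H2: "(\<lambda>n. (H1_norm (\<lambda>x. \<phi> n x - f x))\<^sup>2) \<longlonglongrightarrow> 0" by simp
  have Hsq: "(H1_norm h)\<^sup>2 = (L2_norm h)\<^sup>2 + (\<Sum>j\<in>UNIV. (L2_norm (weak_partial j h))\<^sup>2)" for h
    unfolding H1_norm_def by (intro real_sqrt_pow2 add_nonneg_nonneg sum_nonneg) auto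
  have le: "(\<integral>x. (\<phi> n x - f x)\<^sup>2 \<partial>\<mu>) \<le> (H1_norm (\<lambda>x. \<phi> n x - f x))\<^sup>2" for n
    unfolding Hsq by (simp add: L2_norm_square sum_nonneg)
  have le': "(\<integral>x. (classical_partial 1 (\<phi> n) x - g x)\<^sup>2 \<partial>\<mu>) \<le> (H1_norm (\<lambda>x. \<phi> n x - f x))\<^sup>2" for n
  proof -
    let ?w = "weak_partial 1 (\<lambda>x. \<phi> n x - f x)"
    have d: "(\<lambda>x. classical_partial 1 (\<phi> n) x - g x) \<in> L2"
      by (intro L2_diff smooth_periodic_partial_L2 \<phi> g)
    have w: "is_weak_partial 1 (\<lambda>x. \<phi> n x - f x) (\<lambda>x. classical_partial 1 (\<phi> n) x - g x)"
      by (intro is_weak_partial_diff smooth_weak_normal_partial smooth_periodic_L2 smooth_periodic_partial_L2 \<phi> f g)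
    note spec = weak_partial_spec[OF d w]
    have "(\<integral>x. (classical_partial 1 (\<phi> n) x - g x)\<^sup>2 \<partial>\<mu>) = (\<integral>x. (?w x)\<^sup>2 \<partial>\<mu>)"
    proof (rule integral_cong_AE)
      show "AE x in \<mu>. (classical_partial 1 (\<phi> n) x - g x)\<^sup>2 = (?w x)\<^sup>2"
        using spec(3) by eventually_elim simp
    qed (use L2_square_integrable[OF d] L2_square_integrable[OF spec(1)] in \<open>auto simp: square_integrable_def\<close>)
    also have "\<dots> = (L2_norm ?w)\<^sup>2" by (simp add: L2_norm_square)
    also have "\<dots> \<le> (\<Sum>j\<in>UNIV. (L2_norm (weak_partial j (\<lambda>x. \<phi> n x - f x)))\<^sup>2)"
      by (rule member_le_sum) auto
    also have "\<dots> \<le> (H1_norm (\<lambda>x. \<phi> n x - f x))\<^sup>2" unfolding Hsq by simp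
    finally show ?thesis .
  qed
  have "(\<lambda>n. \<integral>x. (\<phi> n x - f x)\<^sup>2 \<partial>\<mu>) \<longlonglongrightarrow> 0"
    by (rule tendsto_sandwich[OF _ _ tendsto_const H2]) (auto intro!: always_eventually integral_nonneg_AE le)
  moreover have "(\<lambda>n. \<integral>x. (classical_partial 1 (\<phi> n) x - g x)\<^sup>2 \<partial>\<mu>) \<longlonglongrightarrow> 0"
    by (rule tendsto_sandwich[OF _ _ tendsto_const H2]) (auto intro!: always_eventually integral_nonneg_AE le')
  ultimately show thesis
    using \<phi> B f g L2_square_integrable smooth_periodic_L2 smooth_periodic_partial_L2
    by (intro that[of \<phi>]) (auto simp: L2_tendsto_def)
qed

text \<open>
  In the smooth inequality first let the boundary values tend to zero with \<open>d\<close> fixed, which gives a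
  bound that does not depend on \<open>d\<close>; then let \<open>d\<close> decrease to zero and use monotone convergence.
\<close>

lemma Hardy_zero_trace:
  assumes tr: "has_trace f (\<lambda>x. 0)" and g: "g \<in> L2" "is_weak_partial 1 f g"
  shows "square_integrable \<mu> (\<lambda>x. f x / (x $ 1 * (1 - x $ 1)))"
proof -
  obtain \<phi> where \<phi>: "\<And>n. \<phi> n \<in> smooth_periodic" "L2_tendsto \<mu> \<phi> f"
    "L2_tendsto \<mu> (\<lambda>n. classical_partial 1 (\<phi> n)) g" "(\<lambda>n. L2_boundary_norm (\<phi> n)) \<longlonglongrightarrow> 0"
    using zero_trace_approximation[OF assms] by blast
  have fm: "f \<in> borel_measurable \<mu>" using \<phi>(2) by (simp add: L2_tendsto_def square_integrable_def)
  define \<tau> where "\<tau> x = x $ 1 * (1 - x $ 1)" for x :: "real ^ 3"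
  have \<tau>m: "\<tau> \<in> borel_measurable \<mu>"
    unfolding \<tau>_def by (intro borel_measurable_cell) measurable
  have \<tau>0: "\<tau> x > 0" if "x \<in> cell" for x using that by (simp add: \<tau>_def cell_def)
  have sq: "square_integrable \<mu> (\<lambda>x. f x / (\<tau> x + d))"
    and bound: "(\<integral>x. (f x / (\<tau> x + d))\<^sup>2 \<partial>\<mu>) \<le> 8 * (\<integral>x. (g x)\<^sup>2 \<partial>\<mu>)" if d: "d > 0" for d
  proof -
    have "AE x in \<mu>. \<bar>1 / (\<tau> x + d)\<bar> \<le> 1 / d"
    proof (rule AE_I2)
      fix x assume "x \<in> space \<mu>"
      then show "\<bar>1 / (\<tau> x + d)\<bar> \<le> 1 / d" using \<tau>0[of x] d by (simp add: frac_le)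
    qed
    from L2_tendsto_bounded_mult[OF \<phi>(2) _ this]
    have L: "L2_tendsto \<mu> (\<lambda>n x. \<phi> n x / (\<tau> x + d)) (\<lambda>x. f x / (\<tau> x + d))" using \<tau>m by simp
    then show "square_integrable \<mu> (\<lambda>x. f x / (\<tau> x + d))" by (simp add: L2_tendsto_def)
    have "(\<lambda>n. 2 / d * (L2_boundary_norm (\<phi> n))\<^sup>2 + 8 * (\<integral>x. (classical_partial 1 (\<phi> n) x)\<^sup>2 \<partial>\<mu>))
        \<longlonglongrightarrow> 2 / d * 0\<^sup>2 + 8 * (\<integral>x. (g x)\<^sup>2 \<partial>\<mu>)"
      by (intro tendsto_intros \<phi> L2_tendsto_square)
    then show "(\<integral>x. (f x / (\<tau> x + d))\<^sup>2 \<partial>\<mu>) \<le> 8 * (\<integral>x. (g x)\<^sup>2 \<partial>\<mu>)"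
      using Hardy_smooth[OF \<phi>(1) d] by (intro LIMSEQ_le[OF L2_tendsto_square[OF L]]) (auto simp: \<tau>_def)
  qed
  let ?F = "\<lambda>n x. (f x / (\<tau> x + inverse (real (Suc n))))\<^sup>2"
  have mono: "?F m x \<le> ?F n x" if "m \<le> n" "x \<in> cell" for m n x
    unfolding power_divide using that \<tau>0
    by (intro divide_left_mono power_mono add_left_mono mult_pos_pos zero_less_power add_pos_pos)
      (auto simp: less_imp_le add_nonneg_nonneg intro!: le_imp_inverse_le)
  have int: "integrable \<mu> (?F n)" for n
    using sq[of "inverse (real (Suc n))"] by (simp add: square_integrable_def)
  have "incseq (\<lambda>n. \<integral>x. ?F n x \<partial>\<mu>)"
    unfolding incseq_def by (intro allI impI integral_mono int mono) auto
  moreover have "\<forall>n. (\<integral>x. ?F n x \<partial>\<mu>) \<le> 8 * (\<integral>x. (g x)\<^sup>2 \<partial>\<mu>)" using bound by simp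
  ultimately obtain L where L: "(\<lambda>n. \<integral>x. ?F n x \<partial>\<mu>) \<longlonglongrightarrow> L"
    by (rule incseq_convergent)
  have "integrable \<mu> (\<lambda>x. (f x / \<tau> x)\<^sup>2)"
  proof (rule integrable_monotone_convergence[OF int _ _ L])
    show "AE x in \<mu>. mono (\<lambda>n. ?F n x)" by (intro AE_I2 monoI mono) auto
    show "AE x in \<mu>. (\<lambda>n. ?F n x) \<longlonglongrightarrow> (f x / \<tau> x)\<^sup>2"
    proof (rule AE_I2)
      fix x assume "x \<in> space \<mu>"
      then have "\<tau> x + 0 \<noteq> 0" using \<tau>0[of x] by simp
      from tendsto_power[OF tendsto_divide[OF tendsto_const tendsto_add[OF tendsto_const LIMSEQ_inverse_real_of_nat] this]]
      show "(\<lambda>n. ?F n x) \<longlonglongrightarrow> (f x / \<tau> x)\<^sup>2" by simp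
    qed
  qed (use fm \<tau>m in simp)
  then have "square_integrable \<mu> (\<lambda>x. f x / \<tau> x)" using fm \<tau>m by (simp add: square_integrable_def)
  then show ?thesis by (simp only: \<tau>_def)
qed

section \<open>Integration by parts for functions with zero trace\<close>

definition cutoff_deriv :: "real \<Rightarrow> real \<Rightarrow> real" where
  "cutoff_deriv c t = poly_exp [:0, 0, 1:] (c * (t * (1 - t)) - 1) * (c * (1 - 2 * t))"

lemma has_real_derivative_cutoff: "(cutoff c has_real_derivative cutoff_deriv c t) (at t)"
proof -
  have "((\<lambda>t. c * (t * (1 - t)) - 1) has_real_derivative c * (1 - 2 * t)) (at t)"
    by (auto intro!: derivative_eq_intros)
  from DERIV_chain2[OF poly_exp_deriv[of 1] this] show ?thesis
    by (simp add: cutoff_def[abs_def] cutoff_deriv_def pderiv_1)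
qed

lemma continuous_cutoff_deriv: "continuous_on UNIV (cutoff_deriv c)"
proof -
  have "continuous_on UNIV (poly_exp [:0, 0, 1:])"
    by (intro continuous_at_imp_continuous_on ballI) (rule DERIV_isCont[OF poly_exp_deriv])
  then have "continuous_on UNIV (\<lambda>t. poly_exp [:0, 0, 1:] (c * (t * (1 - t)) - 1))"
    by (rule continuous_on_compose2) (auto intro!: continuous_intros)
  then show ?thesis unfolding cutoff_deriv_def[abs_def] by (intro continuous_intros)
qed

text \<open>
  With \<open>r = 1/s\<close> the derivative of \<open>exp(- r)\<close> contributes \<open>r\<^sup>2 exp(- r)\<close>, and the factor \<open>c\<close> from the
  chain rule equals \<open>(s + 1) / (t (1 - t))\<close>.
\<close>

lemma cutoff_deriv_le:
  assumes t: "0 < t" "t < 1" and s: "0 < s" "c * (t * (1 - t)) - 1 = s"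
  shows "\<bar>cutoff_deriv c t\<bar> \<le> ((1 / s)\<^sup>2 + 1 / s) * exp (- (1 / s)) / (t * (1 - t))"
proof -
  have \<tau>: "t * (1 - t) > 0" using t by simp
  have c: "c = (s + 1) / (t * (1 - t))" using s(2) \<tau> by (metis add_diff_cancel_left' add_diff_eq diff_add_cancel less_irrefl nonzero_eq_divide_eq)
  have c0: "c \<ge> 0" unfolding c using s \<tau> by (intro divide_nonneg_pos) auto
  have "\<bar>cutoff_deriv c t\<bar> = (1 / s)\<^sup>2 * exp (- (1 / s)) * (c * \<bar>1 - 2 * t\<bar>)"
    using s c0 by (simp add: cutoff_deriv_def poly_exp_def abs_mult power2_eq_square)
  also have "\<dots> \<le> (1 / s)\<^sup>2 * exp (- (1 / s)) * (c * 1)"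
    using t c0 by (intro mult_left_mono) auto
  also have "\<dots> = ((1 / s)\<^sup>2 + 1 / s) * exp (- (1 / s)) / (t * (1 - t))"
  proof -
    have "(1 / s)\<^sup>2 * (s + 1) = (1 / s)\<^sup>2 + 1 / s"
      using s(1) by (simp add: power2_eq_square field_simps)
    then show ?thesis unfolding c by (simp add: mult.commute mult.left_commute)
  qed
  finally show ?thesis .
qed

text \<open>
  The quantity \<open>(r\<^sup>2 + r) exp(- r)\<close> is at most 2 by the quadratic Taylor bound for the exponential
  function, so the derivative is bounded independently of \<open>c\<close>.
\<close>

lemma cutoff_deriv_bound:
  assumes t: "0 < t" "t < 1"
  shows "\<bar>cutoff_deriv c t\<bar> \<le> 2 / (t * (1 - t))"
proof (cases "c * (t * (1 - t)) - 1 > 0")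
  case True
  define r where "r = 1 / (c * (t * (1 - t)) - 1)"
  have r: "r \<ge> 0" using True by (simp add: r_def)
  have "r\<^sup>2 + r \<le> 2 * exp r" using exp_lower_Taylor_quadratic[OF r] r by simp
  then have "(r\<^sup>2 + r) * exp (- r) \<le> 2 * exp r * exp (- r)" by (rule mult_right_mono) simp
  also have "\<dots> = 2" by (simp flip: exp_add)
  finally have "(r\<^sup>2 + r) * exp (- r) / (t * (1 - t)) \<le> 2 / (t * (1 - t))"
    using t by (intro divide_right_mono) auto
  then show ?thesis using cutoff_deriv_le[OF t True refl] by (simp add: r_def)
next
  case False
  then show ?thesis using t by (simp add: cutoff_deriv_def poly_exp_def)
qed

lemma cutoff_deriv_tendsto_0:
  assumes t: "0 < t" "t < 1"
  shows "(\<lambda>n. cutoff_deriv (real (Suc n)) t) \<longlonglongrightarrow> 0"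
proof -
  define s where "s n = real (Suc n) * (t * (1 - t)) - 1" for n
  have \<tau>: "t * (1 - t) > 0" using t by simp
  have "filterlim (\<lambda>n. real (Suc n) * (t * (1 - t))) at_top sequentially"
    by (rule filterlim_at_top_mult_tendsto_pos[OF tendsto_const \<tau>])
      (use filterlim_sequentially_Suc filterlim_real_sequentially in blast)
  then have lim: "filterlim s at_top sequentially"
    using filterlim_tendsto_add_at_top[OF tendsto_const, of _ sequentially "-1"] unfolding s_def by simp
  have r: "(\<lambda>n. 1 / s n) \<longlonglongrightarrow> 0"
    using tendsto_inverse_0_at_top[OF lim] by (simp add: inverse_eq_divide)
  have "(\<lambda>n. ((1 / s n)\<^sup>2 + 1 / s n) * exp (- (1 / s n)) / (t * (1 - t)))
      \<longlonglongrightarrow> (0\<^sup>2 + 0) * exp (- 0) / (t * (1 - t))"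
    using \<tau> by (intro tendsto_intros r) auto
  then have 0: "(\<lambda>n. ((1 / s n)\<^sup>2 + 1 / s n) * exp (- (1 / s n)) / (t * (1 - t))) \<longlonglongrightarrow> 0" by simp
  show ?thesis
  proof (rule Lim_null_comparison[OF _ 0])
    show "\<forall>\<^sub>F n in sequentially. norm (cutoff_deriv (real (Suc n)) t)
        \<le> ((1 / s n)\<^sup>2 + 1 / s n) * exp (- (1 / s n)) / (t * (1 - t))"
      using lim[unfolded filterlim_at_top_dense, rule_format, of 0]
      by eventually_elim (use cutoff_deriv_le[OF t] in \<open>simp add: s_def\<close>)
  qed
qed

lemma classical_partial_cutoff_mult:
  assumes "\<And>x. f differentiable (at x)"
  shows "classical_partial 1 (\<lambda>x. cutoff c (x $ 1) * f x)
    = (\<lambda>x. cutoff c (x $ 1) * classical_partial 1 f x + cutoff_deriv c (x $ 1) * f x)"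
proof -
  have d: "((\<lambda>x. x $ 1) has_derivative (\<lambda>h. h $ 1)) (at x)" for x :: "real ^ 3"
    by (intro bounded_linear_imp_has_derivative bounded_linear_vec_nth)
  have 1: "classical_partial 1 (\<lambda>x. x $ 1) x = 1" for x
    using classical_partial_eq[OF d, of 1] by simp
  have "classical_partial 1 (\<lambda>x. cutoff c (x $ 1)) = (\<lambda>x. cutoff_deriv c (x $ 1))"
    using classical_partial_compose[OF _ has_real_derivative_cutoff[of c], where f = "\<lambda>x. x $ 1" and j = 1] d
    by (auto simp: 1 differentiable_def)
  moreover have "(\<lambda>x. cutoff c (x $ 1)) differentiable (at x)" for x :: "real ^ 3"
    using C_k_cutoff[OF C_k_coordinate, of 1 c 1] by simp
  ultimately show ?thesis by (simp add: classical_partial_mult assms)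
qed

text \<open>
  Take smooth \<open>\<phi> n\<close> tending to \<open>f\<close> as in the definition of the trace, and let \<open>\<theta> k\<close> be the cutoff with
  parameter \<open>k + 1\<close> and \<open>\<theta>' k\<close> its normal derivative. The product of \<open>\<theta> k\<close> and \<open>\<phi> n\<close> is a test function,
  so the definition of \<open>h\<close> applies to it. Let first \<open>n\<close> tend to infinity with \<open>k\<close> fixed, so that \<open>\<theta>' k\<close> is
  bounded, and then \<open>k\<close>: the integrand \<open>\<theta>' k f v\<close> tends to zero pointwise and is dominated by
  \<open>2 \<bar>f / \<tau>\<bar> \<bar>v\<bar>\<close> with \<open>\<tau> = x\<^sub>1 (1 - x\<^sub>1)\<close>, which is integrable by Hardy's inequality.
\<close>

theorem normal_integration_by_parts:
  assumes tr: "has_trace f (\<lambda>x. 0)" and g: "g \<in> L2" "is_weak_partial 1 f g"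
    and v: "v \<in> L2" "h \<in> L2" "is_weak_partial 1 v h"
  shows "(\<integral>x. g x * v x \<partial>\<mu>) = - (\<integral>x. f x * h x \<partial>\<mu>)"
proof -
  obtain \<phi> where \<phi>: "\<And>n. \<phi> n \<in> smooth_periodic" "L2_tendsto \<mu> \<phi> f"
    "L2_tendsto \<mu> (\<lambda>n. classical_partial 1 (\<phi> n)) g"
    using zero_trace_approximation[OF tr g] by blast
  have hardy: "square_integrable \<mu> (\<lambda>x. f x / (x $ 1 * (1 - x $ 1)))"
    by (rule Hardy_zero_trace[OF tr g])
  have sq: "square_integrable \<mu> f" "square_integrable \<mu> g" "square_integrable \<mu> v" "square_integrable \<mu> h"
    using \<phi> v L2_square_integrable by (auto simp: L2_tendsto_def)
  then have m: "f \<in> borel_measurable \<mu>" "g \<in> borel_measurable \<mu>" "v \<in> borel_measurable \<mu>"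
    "h \<in> borel_measurable \<mu>" by (auto simp: square_integrable_def)
  define \<theta> where "\<theta> k x = cutoff (real (Suc k)) (x $ 1)" for k and x :: "real ^ 3"
  define \<theta>' where "\<theta>' k x = cutoff_deriv (real (Suc k)) (x $ 1)" for k and x :: "real ^ 3"
  have c\<theta>': "continuous_on (cbox 0 1) (\<theta>' k)" for k
    unfolding \<theta>'_def by (rule continuous_on_compose2[OF continuous_cutoff_deriv]) (auto intro!: continuous_intros)
  have c\<theta>: "continuous_on (cbox 0 1) (\<theta> k)" for k
    unfolding \<theta>_def by (rule continuous_on_subset[OF C_k_continuous[OF C_k_cutoff[OF C_k_coordinate]] subset_UNIV])
  have m\<theta>: "\<theta> k \<in> borel_measurable \<mu>" "\<theta>' k \<in> borel_measurable \<mu>" for k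
    by (intro continuous_cell_measurable c\<theta> c\<theta>')+
  have b\<theta>: "\<bar>\<theta> k x\<bar> \<le> 1" for k x
    by (simp add: \<theta>_def cutoff_nonneg cutoff_le_1)
  have AE\<theta>: "AE x in \<mu>. \<bar>\<theta> k x\<bar> \<le> 1" for k by (intro AE_I2 b\<theta>)
  have cut: "(\<integral>x. \<theta> k x * g x * v x \<partial>\<mu>) + (\<integral>x. \<theta>' k x * f x * v x \<partial>\<mu>) = - (\<integral>x. \<theta> k x * f x * h x \<partial>\<mu>)" for k
  proof -
    obtain C where "\<And>x. x \<in> cell \<Longrightarrow> \<bar>\<theta>' k x\<bar> \<le> C" using continuous_cell_bounded[OF c\<theta>'] by metis
    then have AE\<theta>': "AE x in \<mu>. \<bar>\<theta>' k x\<bar> \<le> C" by (intro AE_I2) simp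
    note L = L2_tendsto_bounded_mult[OF \<phi>(3) m\<theta>(1) AE\<theta>, of k] L2_tendsto_bounded_mult[OF \<phi>(2) m\<theta>(2) AE\<theta>']
      L2_tendsto_bounded_mult[OF \<phi>(2) m\<theta>(1) AE\<theta>, of k]
    have eq: "(\<integral>x. \<theta> k x * classical_partial 1 (\<phi> n) x * v x \<partial>\<mu>) + (\<integral>x. \<theta>' k x * \<phi> n x * v x \<partial>\<mu>)
        = - (\<integral>x. \<theta> k x * \<phi> n x * h x \<partial>\<mu>)" for n
    proof -
      have T: "(\<lambda>x. \<theta> k x * \<phi> n x) \<in> test_functions"
        unfolding \<theta>_def by (rule cutoff_mult_test_function[OF \<phi>(1)]) simp
      have "classical_partial 1 (\<lambda>x. \<theta> k x * \<phi> n x)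
          = (\<lambda>x. \<theta> k x * classical_partial 1 (\<phi> n) x + \<theta>' k x * \<phi> n x)"
        unfolding \<theta>_def \<theta>'_def
        by (rule classical_partial_cutoff_mult) (intro smooth_periodic_differentiable \<phi>)
      with bspec[OF v(3)[unfolded is_weak_partial_def] T]
      have "(\<integral>x. v x * (\<theta> k x * classical_partial 1 (\<phi> n) x + \<theta>' k x * \<phi> n x) \<partial>\<mu>)
          = - (\<integral>x. h x * (\<theta> k x * \<phi> n x) \<partial>\<mu>)" by simp
      moreover have "integrable \<mu> (\<lambda>x. v x * (\<theta> k x * classical_partial 1 (\<phi> n) x))"
        "integrable \<mu> (\<lambda>x. v x * (\<theta>' k x * \<phi> n x))"
        using L(1,2) by (auto simp: L2_tendsto_def intro!: square_integrable_mult sq)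
      ultimately show ?thesis by (simp add: distrib_left mult.commute mult.left_commute)
    qed
    have "(\<lambda>n. (\<integral>x. \<theta> k x * classical_partial 1 (\<phi> n) x * v x \<partial>\<mu>) + (\<integral>x. \<theta>' k x * \<phi> n x * v x \<partial>\<mu>))
        \<longlonglongrightarrow> (\<integral>x. \<theta> k x * g x * v x \<partial>\<mu>) + (\<integral>x. \<theta>' k x * f x * v x \<partial>\<mu>)"
      by (intro tendsto_add L2_tendsto_pairing[OF _ sq(3)] L)
    moreover have "(\<lambda>n. - (\<integral>x. \<theta> k x * \<phi> n x * h x \<partial>\<mu>)) \<longlonglongrightarrow> - (\<integral>x. \<theta> k x * f x * h x \<partial>\<mu>)"
      by (intro tendsto_minus L2_tendsto_pairing[OF _ sq(4)] L)
    ultimately show ?thesis unfolding eq by (rule LIMSEQ_unique)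
  qed
  have lim\<theta>: "(\<lambda>k. \<theta> k x) \<longlonglongrightarrow> 1" and lim\<theta>': "(\<lambda>k. \<theta>' k x) \<longlonglongrightarrow> 0" if "x \<in> cell" for x
    using cutoff_tendsto cutoff_deriv_tendsto_0 that by (auto simp: \<theta>_def \<theta>'_def cell_def)
  have lim: "(\<lambda>k. \<integral>x. \<theta> k x * p x * q x \<partial>\<mu>) \<longlonglongrightarrow> (\<integral>x. p x * q x \<partial>\<mu>)"
    if p: "square_integrable \<mu> p" and q: "square_integrable \<mu> q" for p q
  proof (rule integral_dominated_convergence[where w = "\<lambda>x. \<bar>p x * q x\<bar>"])
    show "integrable \<mu> (\<lambda>x. \<bar>p x * q x\<bar>)" using square_integrable_mult[OF p q] by simp
    show "AE x in \<mu>. (\<lambda>k. \<theta> k x * p x * q x) \<longlonglongrightarrow> p x * q x"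
    proof (rule AE_I2)
      fix x assume "x \<in> space \<mu>"
      then have "(\<lambda>k. \<theta> k x * p x * q x) \<longlonglongrightarrow> 1 * p x * q x" by (intro tendsto_intros lim\<theta>) simp
      then show "(\<lambda>k. \<theta> k x * p x * q x) \<longlonglongrightarrow> p x * q x" by simp
    qed
    show "AE x in \<mu>. norm (\<theta> k x * p x * q x) \<le> \<bar>p x * q x\<bar>" for k
      using b\<theta> by (intro AE_I2) (simp add: abs_mult mult_left_le_one_le mult.assoc)
  qed (use p q m\<theta> in \<open>auto simp: square_integrable_def\<close>)
  have "(\<lambda>k. \<integral>x. \<theta>' k x * f x * v x \<partial>\<mu>) \<longlonglongrightarrow> (\<integral>x. 0 \<partial>\<mu>)"
  proof (rule integral_dominated_convergence[where w = "\<lambda>x. 2 * \<bar>f x / (x $ 1 * (1 - x $ 1)) * v x\<bar>"])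
    show "integrable \<mu> (\<lambda>x. 2 * \<bar>f x / (x $ 1 * (1 - x $ 1)) * v x\<bar>)"
      by (intro integrable_mult_right integrable_abs square_integrable_mult hardy sq)
    show "AE x in \<mu>. (\<lambda>k. \<theta>' k x * f x * v x) \<longlonglongrightarrow> 0"
    proof (rule AE_I2)
      fix x assume "x \<in> space \<mu>"
      then have "(\<lambda>k. \<theta>' k x * f x * v x) \<longlonglongrightarrow> 0 * f x * v x" by (intro tendsto_intros lim\<theta>') simp
      then show "(\<lambda>k. \<theta>' k x * f x * v x) \<longlonglongrightarrow> 0" by simp
    qed
    show "AE x in \<mu>. norm (\<theta>' k x * f x * v x) \<le> 2 * \<bar>f x / (x $ 1 * (1 - x $ 1)) * v x\<bar>" for k
    proof (rule AE_I2)
      fix x assume "x \<in> space \<mu>"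
      then have x: "0 < x $ 1" "x $ 1 < 1" by (auto simp: cell_def)
      have "\<bar>\<theta>' k x\<bar> * \<bar>f x * v x\<bar> \<le> 2 / (x $ 1 * (1 - x $ 1)) * \<bar>f x * v x\<bar>"
        unfolding \<theta>'_def by (intro mult_right_mono cutoff_deriv_bound x) simp
      then show "norm (\<theta>' k x * f x * v x) \<le> 2 * \<bar>f x / (x $ 1 * (1 - x $ 1)) * v x\<bar>"
        using x by (simp add: abs_mult mult.assoc)
    qed
  qed (use m m\<theta> in auto)
  then have "(\<lambda>k. (\<integral>x. \<theta> k x * g x * v x \<partial>\<mu>) + (\<integral>x. \<theta>' k x * f x * v x \<partial>\<mu>))
      \<longlonglongrightarrow> (\<integral>x. g x * v x \<partial>\<mu>) + 0"
    by (intro tendsto_add lim sq) simp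
  moreover have "(\<lambda>k. - (\<integral>x. \<theta> k x * f x * h x \<partial>\<mu>)) \<longlonglongrightarrow> - (\<integral>x. f x * h x \<partial>\<mu>)"
    by (intro tendsto_minus lim sq)
  ultimately have "(\<integral>x. g x * v x \<partial>\<mu>) + 0 = - (\<integral>x. f x * h x \<partial>\<mu>)"
    unfolding cut by (rule LIMSEQ_unique)
  then show ?thesis by simp
qed

section \<open>The inequality for the deviatoric gradient\<close>

lemma norm_matrix_square: "(norm A)\<^sup>2 = (\<Sum>i\<in>UNIV. \<Sum>j\<in>UNIV. (A $ i $ j)\<^sup>2)" for A :: "real ^ 'n ^ 'm"
  by (simp add: norm_vec_def L2_set_def sum_nonneg real_sqrt_pow2)

text \<open>
  This is \<open>\<bar>A\<bar>\<^sup>2 + A : A\<^sup>T - (2/3) t\<^sup>2\<close>, arranged so that the last three terms are those that integrate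
  to zero when \<open>A\<close> is the gradient of a field with vanishing normal component on the boundary.
\<close>

lemma half_norm_deviatoric_square:
  fixes A :: "real ^ 3 ^ 3"
  defines "t \<equiv> A $ 1 $ 1 + A $ 2 $ 2 + A $ 3 $ 3"
  shows "1 / 2 * (norm (A + transpose A - ((2 / 3) * t) *\<^sub>R mat 1))\<^sup>2
    = (norm A)\<^sup>2 + 1 / 3 * t\<^sup>2 + 2 * (A $ 1 $ 2 * A $ 2 $ 1 - A $ 1 $ 1 * A $ 2 $ 2)
      + 2 * (A $ 1 $ 3 * A $ 3 $ 1 - A $ 1 $ 1 * A $ 3 $ 3) + 2 * (A $ 2 $ 3 * A $ 3 $ 2 - A $ 2 $ 2 * A $ 3 $ 3)"
  unfolding norm_matrix_square sum_3 t_def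
  by (simp add: transpose_def mat_def power2_eq_square field_simps)

theorem lemma6p1:
  fixes u :: "real ^ 3 \<Rightarrow> real ^ 3"
  assumes "u \<in> V1"
  shows "(L2_norm (grad u))\<^sup>2
    \<le> 1 / 2 * (L2_norm (\<lambda>x. grad u x + transpose (grad u x)
                              - ((2 / 3) * div_field u x) *\<^sub>R mat 1))\<^sup>2"
proof -
  define U where "U i x = u x $ i" for i x
  define G where "G i j = weak_partial j (U i)" for i j
  have tr: "has_trace (U 1) (\<lambda>x. 0)" and H1: "U i \<in> H1" for i
    using assms by (auto simp: V1_def U_def[abs_def])
  have U: "U i \<in> L2" for i using H1 by (simp add: H1_def)
  have G: "G i j \<in> L2" "is_weak_partial j (U i) (G i j)" for i j
  proof -
    obtain g where "g \<in> L2" "is_weak_partial j (U i) g" using H1[of i] by (auto simp: H1_def)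
    from weak_partial_spec[OF this] show "G i j \<in> L2" "is_weak_partial j (U i) (G i j)" by (simp_all add: G_def)
  qed
  have g: "grad u x $ i $ j = G i j x" for x i j by (simp add: grad_def G_def U_def[abs_def])
  have div: "div_field u x = grad u x $ 1 $ 1 + grad u x $ 2 $ 2 + grad u x $ 3 $ 3" for x
    by (simp add: div_field_def grad_def sum_3)
  have ex1: "(\<integral>x. G 1 1 x * G j j x \<partial>\<mu>) = (\<integral>x. G 1 j x * G j 1 x \<partial>\<mu>)" if "j \<noteq> 1" for j
    by (rule exchange_derivatives[of "U 1" _ _ j "U j" _ _ 1])
      (use U G that normal_integration_by_parts[OF tr G] in auto)
  have ex2: "(\<integral>x. G 2 2 x * G 3 3 x \<partial>\<mu>) = (\<integral>x. G 2 3 x * G 3 2 x \<partial>\<mu>)"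
    by (rule exchange_derivatives[of "U 2" _ _ 3 "U 3" _ _ 2])
      (use U G tangential_integration_by_parts[OF U G] in auto)
  have i: "integrable \<mu> (\<lambda>x. G i j x * G k l x)" for i j k l
    by (intro square_integrable_mult L2_square_integrable G)
  let ?d = "\<lambda>x. G 1 1 x + G 2 2 x + G 3 3 x"
  have id: "integrable \<mu> (\<lambda>x. (?d x)\<^sup>2)"
    using square_integrable_add[OF square_integrable_add[OF L2_square_integrable[OF G(1)[of 1 1]]
        L2_square_integrable[OF G(1)[of 2 2]]] L2_square_integrable[OF G(1)[of 3 3]]]
    by (simp add: square_integrable_def)
  have iG: "integrable \<mu> (\<lambda>x. (norm (grad u x))\<^sup>2)"
    unfolding norm_matrix_square g sum_3 unfolding power2_eq_square by (intro Bochner_Integration.integrable_add i)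
  have "1 / 2 * (L2_norm (\<lambda>x. grad u x + transpose (grad u x) - ((2 / 3) * div_field u x) *\<^sub>R mat 1))\<^sup>2
      = (\<integral>x. 1 / 2 * (norm (grad u x + transpose (grad u x) - ((2 / 3) * div_field u x) *\<^sub>R mat 1))\<^sup>2 \<partial>\<mu>)"
    by (simp add: L2_norm_square)
  also have "\<dots> = (\<integral>x. (norm (grad u x))\<^sup>2 + 1 / 3 * (?d x)\<^sup>2 + 2 * (G 1 2 x * G 2 1 x - G 1 1 x * G 2 2 x)
      + 2 * (G 1 3 x * G 3 1 x - G 1 1 x * G 3 3 x) + 2 * (G 2 3 x * G 3 2 x - G 2 2 x * G 3 3 x) \<partial>\<mu>)"
    unfolding div unfolding half_norm_deviatoric_square unfolding g ..
  also have "\<dots> = (\<integral>x. (norm (grad u x))\<^sup>2 \<partial>\<mu>) + 1 / 3 * (\<integral>x. (?d x)\<^sup>2 \<partial>\<mu>)"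
    using i id iG ex1[of 2] ex1[of 3] ex2 by simp
  also have "\<dots> \<ge> (L2_norm (grad u))\<^sup>2"
    by (simp add: L2_norm_square integral_nonneg_AE)
  finally show ?thesis .
qed

end
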